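(* Let $G$ be an abelian Polish group that is not locally compact. Then the additivity of the $\sigma$-ideal of Haar null subsets of $G$ is $\omega_1$.
   Context: An abelian Polish group is an abelian topological group (written additively) whose topology is separable and completely metrizable. A set $X \subset G$ is called Haar null if there exist a Borel set $B \supset X$ and a Borel probability measure $\mu$ on $G$ such that $\mu(B+g)=0$ for every $g \in G$. The Haar null subsets of $G$ form a $\sigma$-ideal (a result of Christensen). The additivity of a $\sigma$-ideal $\mathcal{I}$ of subsets of $G$ is the least cardinality of a family $\mathcal{A} \subset \mathcal{I}$ such that $\bigcup \mathcal{A} \notin \mathcal{I}$. *)

theory Defs
  imports "HOL-Probability.Probability"
begin

unbundle cardinal_syntax

definition haar_null :: "'a::{topological_space, ab_group_add} set \<Rightarrow> bool" where
  "haar_null X \<longleftrightarrow>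
     (\<exists>B \<mu>. B \<in> sets borel \<and> X \<subseteq> B \<and> prob_space \<mu> \<and> sets \<mu> = sets borel \<and>
        (\<forall>g. emeasure \<mu> ((\<lambda>x. x + g) ` B) = 0))"

text \<open>
  Cardinals are well-order relations, compared up to \<open>=o\<close>. The relation \<open>\<kappa>\<close> lives on an
  arbitrary type, so that it need not be carried by the type of families. It is a predicate
  rather than a function because a family with union outside the ideal need not exist
  (when the ideal contains the union of all its members).
\<close>

definition has_additivity :: "'a set set \<Rightarrow> 'k rel \<Rightarrow> bool" where
  "has_additivity I \<kappa> \<longleftrightarrow>
     Card_order \<kappa> \<and>
     (\<exists>A \<subseteq> I. \<Union>A \<notin> I \<and> |A| =o \<kappa>) \<and>
     (\<forall>A \<subseteq> I. \<Union>A \<notin> I \<longrightarrow> \<kappa> \<le>o |A| )"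

definition omega_1 :: "nat set rel" where
  "omega_1 = cardSuc natLeq"

end

theory Submission
  imports Defs "HOL-Library.Diagonal_Subsequence" "HOL-Library.Countable_Set_Type"
begin

text \<open>
  That countable unions of Haar null sets are Haar null is Christensen's theorem: add up
  independent witnesses concentrated near \<open>0\<close>.

  For the other bound, enumerate the Borel functions \<open>G \<rightarrow> G\<close> by jointly Borel families
  \<open>H \<xi>\<close>, \<open>\<xi> < \<omega>\<^sub>1\<close>, indexed by \<open>y \<in> \<omega>\<^sup>\<omega>\<close>. As \<open>G\<close> is not locally compact, there are translations
  \<open>t k\<close>, \<open>k \<in> \<omega>\<^sup>\<omega>\<close>, moving sets \<open>K k\<close>, some of which contains any given compact set, so far apart
  that \<open>k\<close> can be recovered in a Borel way from every point of \<open>K k + t k - C\<close>, where \<open>C\<close> is a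
  fixed Cantor set. Let \<open>E \<xi>\<close> consist of the points \<open>H \<xi> y (t k) + t k\<close> where \<open>k\<close> encodes \<open>y\<close> and
  \<open>H \<xi> y (t k) \<in> K k\<close>. A translate of \<open>C\<close> meets \<open>E \<xi>\<close> in at most one point, so \<open>E \<xi>\<close> is Haar null.
  If a Borel set \<open>B\<close> containing all \<open>E \<xi>\<close> had a witness \<open>\<mu>\<close>, then, \<open>\<mu>\<close> being tight, a measurable
  uniformization would give a compact set \<open>L\<close> and a Borel function \<open>h\<close> with \<open>h t \<in> L\<close> and
  \<open>h t + t \<notin> B\<close> for all \<open>t\<close>. But \<open>h\<close> is some \<open>H \<xi> y\<close>; choosing \<open>k\<close> that encodes \<open>y\<close> with \<open>L \<subseteq> K k\<close>
  yields the point \<open>h (t k) + t k\<close> of \<open>E \<xi>\<close> outside \<open>B\<close>.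
\<close>

section \<open>Neighbourhoods of zero and completeness\<close>

lemma exists_dense_sequence:
  obtains d :: "nat \<Rightarrow> 'a::second_countable_topology"
  where "\<And>U. open U \<Longrightarrow> U \<noteq> {} \<Longrightarrow> \<exists>i. d i \<in> U"
proof -
  obtain D :: "'a set" where D: "countable D" "\<And>U. open U \<Longrightarrow> U \<noteq> {} \<Longrightarrow> \<exists>d\<in>D. d \<in> U"
    using countable_dense_setE by blast
  then have "D \<noteq> {}" using open_UNIV by blast
  have "\<exists>i. from_nat_into D i \<in> U" if "open U" "U \<noteq> {}" for U
    using D(2)[OF that] range_from_nat_into[OF \<open>D \<noteq> {}\<close> D(1)] by (metis rangeE)
  then show thesis by (rule that)
qed

lemma Cauchy_if_dist_Suc_le_half_power:
  fixes u :: "nat \<Rightarrow> 'a::metric_space"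
  assumes "\<And>k. dist (u k) (u (Suc k)) \<le> (1/2)^k"
  shows "Cauchy u"
proof (rule CauchyI')
  have *: "dist (u m) (u (m + j)) \<le> 2 * (1/2)^m - 2 * (1/2)^(m + j)" for m j
  proof (induction j)
    case (Suc j)
    have "dist (u m) (u (m + Suc j)) \<le> dist (u m) (u (m + j)) + dist (u (m + j)) (u (Suc (m + j)))"
      using dist_triangle[of "u m" "u (m + Suc j)" "u (m + j)"] by simp
    then show ?case using Suc assms[of "m + j"] by simp
  qed simp
  fix e :: real assume "e > 0"
  then obtain M where M: "(1/2)^M < e / 2" using real_arch_pow_inv[of "e/2" "1/2"] by auto
  have "dist (u m) (u n) < e" if "m \<ge> M" "n > m" for m n
  proof -
    have "dist (u m) (u n) \<le> 2 * (1/2)^m - 2 * (1/2)^n" using *[of m "n - m"] that by simp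
    also have "\<dots> < 2 * (1/2)^m" by simp
    also have "\<dots> \<le> 2 * (1/2)^M" using that by (simp add: power_decreasing)
    finally show ?thesis using M by simp
  qed
  then show "\<exists>M. \<forall>m\<ge>M. \<forall>n>m. dist (u m) (u n) < e" by blast
qed

text \<open>Substitute for a translation invariant metric: \<open>V n\<close> behaves like the ball
  of radius \<open>(1/2)^n\<close> about zero.\<close>

locale zero_nbhd_base =
  fixes V :: "nat \<Rightarrow> 'a::{metric_space, topological_ab_group_add} set"
  assumes V_open: "open (V n)"
    and V_zero: "0 \<in> V n"
    and V_uminus: "x \<in> V n \<Longrightarrow> - x \<in> V n"
    and V_add: "x \<in> V (Suc n) \<Longrightarrow> y \<in> V (Suc n) \<Longrightarrow> x + y \<in> V n"
    and V_base: "open U \<Longrightarrow> 0 \<in> U \<Longrightarrow> \<exists>n. V n \<subseteq> U"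

text \<open>Continuity of addition at \<open>(0, 0)\<close> gives \<open>V_add\<close>, intersecting
  with the reflected set gives symmetry, and the balls of radius \<open>1 / Suc n\<close> force a
  base.\<close>

lemma exists_zero_nbhd_base:
  "\<exists>V :: nat \<Rightarrow> 'a::{metric_space, topological_ab_group_add} set. zero_nbhd_base V"
proof -
  let ?P = "\<lambda>(n::nat) (W::'a set). open W \<and> 0 \<in> W \<and> (\<forall>x\<in>W. - x \<in> W) \<and> W \<subseteq> ball 0 (1 / Suc n)"
  let ?Q = "\<lambda>(n::nat) (W::'a set) W'. \<forall>x\<in>W'. \<forall>y\<in>W'. x + y \<in> W"
  have step: "\<exists>W'. ?P n W' \<and> ?Q n U W'" if "open U" "0 \<in> U" for U :: "'a set" and n
  proof -
    have "open ((\<lambda>p. fst p + snd p) -` U)"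
      by (rule open_vimage[OF \<open>open U\<close>]) (intro continuous_intros)
    moreover have "(0, 0) \<in> (\<lambda>p. fst p + snd p) -` U" using that by simp
    ultimately obtain A B where AB: "open A" "open B" "0 \<in> A" "0 \<in> B" "A \<times> B \<subseteq> (\<lambda>p. fst p + snd p) -` U"
      by (elim open_prod_elim) auto
    define W where "W = A \<inter> B \<inter> ball 0 (1 / Suc n)"
    define W' where "W' = W \<inter> uminus -` W"
    have "open W" unfolding W_def using AB by auto
    then have "open W'" unfolding W'_def by (intro open_Int open_vimage continuous_intros) auto
    moreover have "0 \<in> W'" unfolding W'_def W_def using AB by auto
    moreover have "\<forall>x\<in>W'. - x \<in> W'" by (auto simp: W'_def)
    moreover have "x + y \<in> U" if "x \<in> W'" "y \<in> W'" for x y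
      using that AB(5) by (auto simp: W'_def W_def)
    moreover have "W' \<subseteq> ball 0 (1 / Suc n)" by (auto simp: W'_def W_def)
    ultimately show ?thesis by blast
  qed
  have "\<exists>V. \<forall>n. ?P n (V n) \<and> ?Q n (V n) (V (Suc n))"
  proof (rule dependent_nat_choice)
    show "\<exists>W. ?P 0 W" using step[of UNIV 0] by auto
    show "\<exists>W'. ?P (Suc n) W' \<and> ?Q n W W'" if "?P n W" for W n
      by (rule step) (use that in auto)
  qed
  then obtain V where V': "\<forall>n. ?P n (V n) \<and> ?Q n (V n) (V (Suc n))" by (elim exE)
  have V: "?P n (V n)" "?Q n (V n) (V (Suc n))" for n using V' by simp_all
  have base: "\<exists>n. V n \<subseteq> U" if U: "open U" "0 \<in> U" for U
  proof -
    obtain e where e: "e > 0" "ball 0 e \<subseteq> U" using U open_contains_ball by blast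
    obtain n where "1 / Suc n < e" using \<open>e > 0\<close> nat_approx_posE by blast
    then have "ball 0 (1 / Suc n) \<subseteq> ball (0::'a) e" by (intro subset_ball) simp
    then have "V n \<subseteq> U" using V(1)[of n] e(2) by blast
    then show ?thesis by blast
  qed
  have "zero_nbhd_base V"
  proof (rule zero_nbhd_base.intro)
    show "x + y \<in> V n" if "x \<in> V (Suc n)" "y \<in> V (Suc n)" for x y n
      using V(2)[of n] that by blast
    show "open (V n)" "0 \<in> V n" for n using V(1)[of n] by blast+
    show "- x \<in> V n" if "x \<in> V n" for x n using V(1)[of n] that by blast
  qed (rule base)
  then show ?thesis by blast
qed

context zero_nbhd_base
begin

lemma V_Suc_subset: "V (Suc n) \<subseteq> V n"
proof
  fix x assume "x \<in> V (Suc n)"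
  from V_add[OF this V_zero] show "x \<in> V n" by simp
qed

lemma V_decseq: "m \<le> n \<Longrightarrow> V n \<subseteq> V m"
  by (rule lift_Suc_antimono_le[of V, OF V_Suc_subset])

lemma V_diff: "x \<in> V (Suc n) \<Longrightarrow> y \<in> V (Suc n) \<Longrightarrow> x - y \<in> V n"
  using V_add[of x n "- y"] V_uminus[of y "Suc n"] by simp

lemma V_add_less: "x \<in> V a \<Longrightarrow> y \<in> V b \<Longrightarrow> n < a \<Longrightarrow> n < b \<Longrightarrow> x + y \<in> V n"
  using V_add[of x n y] V_decseq[of "Suc n" a] V_decseq[of "Suc n" b] by auto

lemma V_diff_less: "x \<in> V a \<Longrightarrow> y \<in> V b \<Longrightarrow> n < a \<Longrightarrow> n < b \<Longrightarrow> x - y \<in> V n"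
  using V_diff[of x n y] V_decseq[of "Suc n" a] V_decseq[of "Suc n" b] by auto

lemma open_translate_V: "open {x. x - a \<in> V n}"
proof -
  have "open ((\<lambda>x. x - a) -` V n)" by (intro open_vimage V_open continuous_intros)
  then show ?thesis by (simp add: vimage_def)
qed

lemma V_continuous:
  assumes "e > 0" shows "\<exists>r. \<forall>x\<in>V r. dist (g + x) g < e"
proof -
  have "open ((\<lambda>x. g + x) -` ball g e)" by (intro open_vimage continuous_intros) simp
  moreover have "0 \<in> (\<lambda>x. g + x) -` ball g e" using assms by simp
  ultimately obtain r where "V r \<subseteq> (\<lambda>x. g + x) -` ball g e" using V_base by metis
  then have "dist (g + x) g < e" if "x \<in> V r" for x
    using that by (metis dist_commute mem_ball subsetD vimageE)
  then show ?thesis by blast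
qed

lemma eventually_diff_in_V: "X \<longlonglongrightarrow> a \<Longrightarrow> eventually (\<lambda>n. a - X n \<in> V m) sequentially"
proof -
  assume "X \<longlonglongrightarrow> a"
  then have "(\<lambda>n. a - X n) \<longlonglongrightarrow> a - a" by (intro tendsto_intros)
  then show ?thesis using topological_tendstoD[OF _ V_open, of _ "a - a"] V_zero by simp
qed

lemma LIMSEQ_iff_V: "X \<longlonglongrightarrow> a \<longleftrightarrow> (\<forall>m. \<exists>N. \<forall>n\<ge>N. X n - a \<in> V m)"
proof
  assume X: "X \<longlonglongrightarrow> a"
  show "\<forall>m. \<exists>N. \<forall>n\<ge>N. X n - a \<in> V m"
  proof
    fix m
    from eventually_diff_in_V[OF X, of m] obtain N where "\<forall>n\<ge>N. a - X n \<in> V m"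
      unfolding eventually_sequentially by blast
    then have "\<forall>n\<ge>N. X n - a \<in> V m" using V_uminus by (metis minus_diff_eq)
    then show "\<exists>N. \<forall>n\<ge>N. X n - a \<in> V m" by blast
  qed
next
  assume *: "\<forall>m. \<exists>N. \<forall>n\<ge>N. X n - a \<in> V m"
  have "(\<lambda>n. X n - a) \<longlonglongrightarrow> 0"
  proof (rule topological_tendstoI)
    fix S :: "'a set" assume "open S" "0 \<in> S"
    then obtain m where "V m \<subseteq> S" using V_base by blast
    then show "eventually (\<lambda>n. X n - a \<in> S) sequentially"
      using * unfolding eventually_sequentially by blast
  qed
  then have "(\<lambda>n. (X n - a) + a) \<longlonglongrightarrow> 0 + a" by (intro tendsto_intros)
  then show "X \<longlonglongrightarrow> a" by simp
qed

end

section \<open>Completeness: convergent series and compact neighbourhoods\<close>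

locale polish_zero_nbhd_base = zero_nbhd_base V
  for V :: "nat \<Rightarrow> 'a::{polish_space, topological_ab_group_add} set"
begin

text \<open>
  Klee's theorem. The metric of the space need not be translation invariant, so group Cauchy
  sequences need not be Cauchy. One decomposes a subsequence of \<open>X\<close> as \<open>g k + g' k\<close>, alternately
  correcting one of the two summands; each correction is small compared with the modulus
  of continuity of translation at the other summand, and both summands become Cauchy.
\<close>

lemma group_Cauchy_convergent:
  assumes X: "\<And>m. \<exists>N. \<forall>i\<ge>N. \<forall>j\<ge>N. X i - X j \<in> V m"
  shows "convergent X"
proof -
  \<comment> \<open>State of the recursion: \<open>g + g'\<close> splits \<open>X N\<close>, the
    tail from \<open>N\<close> on stays within \<open>V r\<close> of \<open>X N\<close>, and
    \<open>V r\<close> moves \<open>g'\<close> by less than \<open>(1/2)^k\<close>.\<close>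
  let ?P = "\<lambda>k (g, g', N, r). k \<le> N \<and> g + g' = X N \<and> (\<forall>i\<ge>N. X i - X N \<in> V r) \<and>
    (\<forall>x\<in>V r. dist (g' + x) g' < (1/2)^k)"
  let ?Q = "\<lambda>k (g, g', N, r) (h, h', M, s). dist g h < (1/2::real)^k \<and> dist g' h' < (1/2::real)^k"
  have step: "\<exists>h h' M s. ?P (Suc k) (h, h', M, s) \<and> ?Q k (g, g', N, r) (h, h', M, s)"
    if P: "(\<forall>i\<ge>N. X i - X N \<in> V r)" "(\<forall>x\<in>V r. dist (g' + x) g' < (1/2)^k)" "g + g' = X N"
    for k g g' N r
  proof -
    obtain s where s: "\<forall>x\<in>V s. dist (g + x) g < (1/2)^k"
      using V_continuous[of "(1/2)^k" g] by auto
    obtain M0 where M0: "\<forall>i\<ge>M0. \<forall>j\<ge>M0. X i - X j \<in> V s" using X by blast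
    define M where "M = max M0 N"
    \<comment> \<open>First \<open>g'\<close> absorbs \<open>X M - X N\<close>, an element of
      \<open>V r\<close>. As \<open>M\<close> lies beyond \<open>M0\<close>, the correction
      \<open>X M' - X M\<close> that \<open>g\<close> absorbs afterwards lies in
      \<open>V s\<close>.\<close>
    define h' where "h' = X M - g"
    have h': "h' = g' + (X M - X N)" using P(3) by (simp add: h'_def algebra_simps)
    have d': "dist g' h' < (1/2)^k"
      using P(1,2) unfolding h' by (simp add: M_def dist_commute)
    obtain s0 where s0: "\<forall>x\<in>V s0. dist (h' + x) h' < (1/2)^Suc k"
      using V_continuous[of "(1/2)^Suc k" h'] by auto
    define s' where "s' = max s s0"
    obtain M1 where M1: "\<forall>i\<ge>M1. \<forall>j\<ge>M1. X i - X j \<in> V s'" using X by blast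
    define M' where "M' = Max {M, M1, Suc k}"
    have M': "M \<le> M'" "M1 \<le> M'" "Suc k \<le> M'" by (auto simp: M'_def)
    define h where "h = X M' - h'"
    have h: "h = g + (X M' - X M)" by (simp add: h_def h'_def algebra_simps)
    have dV: "X M' - X M \<in> V s" using M0 M' by (auto simp: M_def)
    have d1: "dist h g < (1/2)^k" using s dV unfolding h by blast
    have **: "dist (h' + x) h' < (1/2)^Suc k" if "x \<in> V s'" for x
      using that s0 V_decseq[of s0 s'] by (auto simp: s'_def)
    have "?P (Suc k) (h, h', M', s') \<and> ?Q k (g, g', N, r) (h, h', M', s')"
      using ** d' d1 M' M1 by (auto simp: dist_commute h_def)
    then show ?thesis by blast
  qed
  have init: "\<exists>z. ?P 0 z"
  proof -
    obtain r where r: "\<forall>x\<in>V r. dist (0 + x) 0 < 1" using V_continuous[of 1 0] by auto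
    obtain N where N: "\<forall>i\<ge>N. \<forall>j\<ge>N. X i - X j \<in> V r" using X by blast
    then have "?P 0 (X N, 0, N, r)" using r by auto
    then show ?thesis by blast
  qed
  have "\<exists>f. \<forall>k. ?P k (f k) \<and> ?Q k (f k) (f (Suc k))"
  proof (rule dependent_nat_choice)
    show "\<exists>z. ?P 0 z" by (rule init)
    fix z k assume "?P k z"
    moreover obtain g g' N r where z: "z = (g, g', N, r)" by (cases z) auto
    ultimately obtain h h' M s where "?P (Suc k) (h, h', M, s) \<and> ?Q k (g, g', N, r) (h, h', M, s)"
      using step[of N r g' k g] by auto
    then show "\<exists>y. ?P (Suc k) y \<and> ?Q k z y"
      unfolding z by (intro exI[of _ "(h, h', M, s)"])
  qed
  then obtain f where f': "\<forall>k. ?P k (f k) \<and> ?Q k (f k) (f (Suc k))" by (elim exE)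
  have f: "?P k (f k)" "?Q k (f k) (f (Suc k))" for k using f' by simp_all
  define g g' N where "g k = fst (f k)" and "g' k = fst (snd (f k))" and "N k = fst (snd (snd (f k)))" for k
  have *: "k \<le> N k" "g k + g' k = X (N k)" "dist (g k) (g (Suc k)) < (1/2)^k"
    "dist (g' k) (g' (Suc k)) < (1/2)^k" for k
    using f(1)[of k] f(2)[of k] by (auto simp: g_def g'_def N_def split: prod.splits)
  have conv: "convergent u" if "\<And>k. dist (u k) (u (Suc k)) < (1/2)^k" for u :: "nat \<Rightarrow> 'a"
    by (intro Cauchy_convergent Cauchy_if_dist_Suc_le_half_power less_imp_le that)
  obtain a a' where "g \<longlonglongrightarrow> a" "g' \<longlonglongrightarrow> a'"
    using conv[of g] conv[of g'] * unfolding convergent_def by blast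
  then have "(\<lambda>k. g k + g' k) \<longlonglongrightarrow> a + a'" by (rule tendsto_add)
  then have lim: "(\<lambda>k. X (N k)) \<longlonglongrightarrow> a + a'" by (simp add: *)
  \<comment> \<open>A group Cauchy sequence follows its convergent subsequence.\<close>
  have "X \<longlonglongrightarrow> a + a'"
    unfolding LIMSEQ_iff_V
  proof
    fix m
    obtain n1 where n1: "\<forall>i\<ge>n1. \<forall>j\<ge>n1. X i - X j \<in> V (Suc m)" using X by blast
    obtain n2 where n2: "\<forall>k\<ge>n2. X (N k) - (a + a') \<in> V (Suc m)" using lim[unfolded LIMSEQ_iff_V, rule_format, of "Suc m"] by blast
    have "X i - (a + a') \<in> V m" if "i \<ge> max n1 n2" for i
    proof -
      have "X i - X (N i) \<in> V (Suc m)" using n1 that *(1)[of i] by auto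
      moreover have "X (N i) - (a + a') \<in> V (Suc m)" using n2 that by auto
      ultimately have "(X i - X (N i)) + (X (N i) - (a + a')) \<in> V m" by (rule V_add)
      moreover have "(X i - X (N i)) + (X (N i) - (a + a')) = X i - (a + a')" by (simp add: algebra_simps)
      ultimately show ?thesis by simp
    qed
    then show "\<exists>n. \<forall>i\<ge>n. X i - (a + a') \<in> V m" by blast
  qed
  then show ?thesis by (auto simp: convergent_def)
qed

text \<open>Analogue of \<open>1/2 + 1/4 + ... < 1\<close>: the first term and, by induction, the
  sum of the others lie in \<open>V (Suc a)\<close>.\<close>

lemma sum_in_V:
  assumes "\<And>i. i < N \<Longrightarrow> x i \<in> V (Suc a + i)"
  shows "(\<Sum>i<N. x i) \<in> V a"
  using assms
proof (induction N arbitrary: a x)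
  case 0
  then show ?case by (simp add: V_zero)
next
  case (Suc N)
  have "(\<Sum>i<N. x (Suc i)) \<in> V (Suc a)"
    using Suc.prems[of "Suc _"] by (intro Suc.IH) simp
  moreover have "x 0 \<in> V (Suc a)" using Suc.prems[of 0] by simp
  ultimately show ?case unfolding sum.lessThan_Suc_shift by (intro V_add)
qed

text \<open>Two levels are spent, one on the partial sums and one on the limit. Blocks of terms from
  \<open>j\<close> on lie in \<open>V (Suc a + j)\<close>, so the partial sums are group
  Cauchy.\<close>

lemma suminf_in_V:
  assumes x: "\<And>i. x i \<in> V (Suc (Suc a) + i)"
  shows "summable x" "suminf x \<in> V a"
proof -
  let ?S = "\<lambda>n::nat. \<Sum>i<n. x i"
  have block: "?S k - ?S j \<in> V (Suc a + j)" if "j \<le> k" for j k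
  proof -
    have "?S k - ?S j = (\<Sum>i\<in>{..<k} - {..<j}. x i)" using that by (subst sum_diff) auto
    also have "\<dots> = (\<Sum>i<k - j. x (j + i))"
      by (rule sum.reindex_bij_witness[of _ "\<lambda>i. j + i" "\<lambda>i. i - j"]) auto
    also have "\<dots> \<in> V (Suc a + j)" using x[of "j + _"] by (intro sum_in_V) (simp add: ac_simps)
    finally show ?thesis .
  qed
  have "convergent ?S"
  proof (rule group_Cauchy_convergent, intro exI allI impI)
    fix m i j :: nat assume ij: "m \<le> i" "m \<le> j"
    have *: "?S k - ?S l \<in> V m" "?S l - ?S k \<in> V m" if "l \<le> k" "m \<le> l" for k l :: nat
    proof -
      have "?S k - ?S l \<in> V m" using block[OF that(1)] V_decseq[of m "Suc a + l"] that by auto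
      then show "?S k - ?S l \<in> V m" "?S l - ?S k \<in> V m" using V_uminus[of "?S k - ?S l" m] by auto
    qed
    show "?S i - ?S j \<in> V m"
      by (cases "i \<le> j") (use *[of i j] *[of j i] ij in auto)
  qed
  then show "summable x" by (simp add: summable_iff_convergent)
  then have "?S \<longlonglongrightarrow> suminf x" by (rule summable_LIMSEQ)
  from eventually_happens[OF eventually_diff_in_V[OF this, of "Suc a"]] obtain n
    where "suminf x - ?S n \<in> V (Suc a)" by auto
  moreover have "?S n \<in> V (Suc a)" using block[of 0 n] by simp
  ultimately have "(suminf x - ?S n) + ?S n \<in> V a" by (rule V_add)
  then show "suminf x \<in> V a" by simp
qed

lemma closure_V_Suc_subset: "closure (V (Suc n)) \<subseteq> V n"
proof
  fix x assume "x \<in> closure (V (Suc n))"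
  then have "V (Suc n) \<inter> {y. y - x \<in> V (Suc n)} \<noteq> {}"
    using open_translate_V[of x "Suc n"] V_zero[of "Suc n"] unfolding closure_iff_nhds_not_empty
    by (metis (no_types, lifting) diff_self mem_Collect_eq order_refl)
  then obtain y where "y - x \<in> V (Suc n)" "y \<in> V (Suc n)" by auto
  then show "x \<in> V n" using V_diff[of y n "y - x"] by simp
qed

text \<open>At each level the pigeonhole principle keeps infinitely many terms near one centre; the
  diagonal subsequence is group Cauchy, hence convergent by Klee's theorem.\<close>

lemma totally_bounded_imp_compact_closure:
  assumes tb: "\<And>m. \<exists>F. finite F \<and> V n \<subseteq> (\<Union>f\<in>F. {x. x - f \<in> V m})"
  shows "compact (closure (V (Suc n)))"
  unfolding compact_eq_seq_compact_metric seq_compact_def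
proof (intro allI impI)
  fix x :: "nat \<Rightarrow> 'a" assume x: "\<forall>k. x k \<in> closure (V (Suc n))"
  let ?P = "\<lambda>m (s :: nat \<Rightarrow> nat). \<forall>i j. x (s i) - x (s j) \<in> V m"
  interpret subseqs ?P
  proof
    fix m and s :: "nat \<Rightarrow> nat" assume s: "strict_mono s"
    obtain F where F: "finite F" "V n \<subseteq> (\<Union>f\<in>F. {x. x - f \<in> V (Suc m)})" using tb by blast
    have "\<forall>k. \<exists>f\<in>F. x (s k) - f \<in> V (Suc m)" using F x closure_V_Suc_subset[of n] by blast
    then obtain c where c: "\<And>k. c k \<in> F" "\<And>k. x (s k) - c k \<in> V (Suc m)" by metis
    have "finite (range c)" using F(1) c(1) by (rule_tac finite_subset) auto
    then obtain k0 where "infinite {k. c k = c k0}"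
      using pigeonhole_infinite[of UNIV c] by auto
    then obtain r :: "nat \<Rightarrow> nat" where r: "strict_mono r" "\<And>i. r i \<in> {k. c k = c k0}"
      using infinite_enumerate by blast
    have "x (s (r i)) - x (s (r j)) \<in> V m" for i j
      using V_diff[of "x (s (r i)) - c k0" m "x (s (r j)) - c k0"] c(2)[of "r i"] c(2)[of "r j"] r(2) by simp
    with r(1) have "strict_mono r \<and> (\<forall>i j. x ((s \<circ> r) i) - x ((s \<circ> r) j) \<in> V m)" by simp
    then show "\<exists>r'::nat \<Rightarrow> nat. strict_mono r' \<and> (\<forall>i j. x ((s \<circ> r') i) - x ((s \<circ> r') j) \<in> V m)" by (rule exI[of _ r])
  qed
  have "convergent (x \<circ> diagseq)"
  proof (rule group_Cauchy_convergent)
    fix m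
    have *: "?P m (diagseq \<circ> ((+) (Suc m)))" by (rule diagseq_holds) auto
    have "x (diagseq i) - x (diagseq j) \<in> V m" if "i \<ge> Suc m" "j \<ge> Suc m" for i j
      using *[rule_format, of "i - Suc m" "j - Suc m"] that by simp
    then show "\<exists>N. \<forall>i\<ge>N. \<forall>j\<ge>N. (x \<circ> diagseq) i - (x \<circ> diagseq) j \<in> V m" by auto
  qed
  then obtain l where l: "(x \<circ> diagseq) \<longlonglongrightarrow> l" by (auto simp: convergent_def)
  moreover have "l \<in> closure (V (Suc n))"
    by (rule closed_sequentially[OF closed_closure _ l]) (use x in auto)
  ultimately show "\<exists>l\<in>closure (V (Suc n)). \<exists>r. strict_mono r \<and> (x \<circ> r) \<longlonglongrightarrow> l"
    using subseq_diagseq by blast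
qed

text \<open>Otherwise zero would have a compact neighbourhood, and translations would carry it to
  every point.\<close>

lemma V_not_totally_bounded:
  assumes "\<not> locally_compact_space (euclidean :: 'a topology)"
  shows "\<exists>m. \<forall>F. finite F \<longrightarrow> \<not> V n \<subseteq> (\<Union>f\<in>F. {x. x - f \<in> V m})"
proof (rule ccontr)
  assume "\<not> ?thesis"
  then have comp: "compact (closure (V (Suc n)))"
    by (intro totally_bounded_imp_compact_closure) blast
  have "\<exists>U K. open U \<and> compact K \<and> a \<in> U \<and> U \<subseteq> K" for a :: 'a
  proof (intro exI conjI)
    show "open {x. x - a \<in> V (Suc n)}" by (rule open_translate_V)
    show "compact ((\<lambda>x. x + a) ` closure (V (Suc n)))"
      by (intro compact_continuous_image comp continuous_intros)
    show "a \<in> {x. x - a \<in> V (Suc n)}" by (simp add: V_zero)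
    show "{x. x - a \<in> V (Suc n)} \<subseteq> (\<lambda>x. x + a) ` closure (V (Suc n))"
    proof
      fix x assume "x \<in> {x. x - a \<in> V (Suc n)}"
      then have "x - a \<in> closure (V (Suc n))" using closure_subset by blast
      then show "x \<in> (\<lambda>x. x + a) ` closure (V (Suc n))" by (rule rev_image_eqI) simp
    qed
  qed
  then have "locally_compact_space (euclidean :: 'a topology)"
    by (simp add: locally_compact_space_def)
  then show False using assms by contradiction
qed

end

section \<open>Countable unions of Haar null sets\<close>

lemma borel_measurable_group_diff:
  fixes f g :: "'b \<Rightarrow> 'a::{second_countable_topology, topological_group_add}"
  assumes "f \<in> borel_measurable M" "g \<in> borel_measurable M"
  shows "(\<lambda>x. f x - g x) \<in> borel_measurable M"
  using assms by (rule borel_measurable_continuous_Pair) (intro continuous_intros)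

lemma translate_eq_Collect: "(\<lambda>x. x + g) ` B = {x::'a::group_add. x - g \<in> B}"
  by (auto intro: rev_image_eqI)

lemma borel_translate:
  fixes B :: "'a::{second_countable_topology, topological_group_add} set"
  assumes "B \<in> sets borel"
  shows "{x. x - g \<in> B} \<in> sets borel"
proof -
  have "(\<lambda>x. x - g) \<in> borel_measurable borel" by (intro borel_measurable_group_diff) auto
  from measurable_sets[OF this assms] show ?thesis by (simp add: vimage_def)
qed

lemma haar_null_empty: "haar_null ({} :: 'a::{topological_space, ab_group_add} set)"
  unfolding haar_null_def
  by (intro exI[of _ "{}"] exI[of _ "return borel 0"]) (auto intro: prob_space_return)

section \<open>Small independent witnesses and their sum\<close>

context polish_zero_nbhd_base
begin

lemma UN_translate_V:
  assumes "\<And>U. open U \<Longrightarrow> U \<noteq> {} \<Longrightarrow> \<exists>d\<in>D. d \<in> U"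
  shows "(\<Union>d\<in>D. {x. x - d \<in> V m}) = UNIV"
proof -
  have "\<exists>d\<in>D. x - d \<in> V m" for x
  proof -
    have "x \<in> {y. y - x \<in> V m}" using V_zero[of m] by simp
    then obtain d where "d \<in> D" "d - x \<in> V m"
      using assms[of "{y. y - x \<in> V m}", OF open_translate_V] by blast
    then show ?thesis using V_uminus[of "d - x" m] by auto
  qed
  then show ?thesis by auto
qed

text \<open>Countably many translates of \<open>V m\<close> cover the group, so one has positive
  measure; conditioning on it and translating it to zero localizes the witness. It is given as a
  function on a probability space so that independent ones can be added pointwise.\<close>

lemma haar_null_witness_in_V:
  assumes "haar_null X"
  obtains B and M :: "'a measure" and f where "B \<in> sets borel" "X \<subseteq> B" "prob_space M" "sets M = sets borel"
    "f \<in> borel_measurable M" "\<And>x. f x \<in> V m" "\<And>g. emeasure M {x. f x - g \<in> B} = 0"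
proof -
  obtain B \<mu> where B: "B \<in> sets borel" "X \<subseteq> B" and \<mu>: "prob_space \<mu>" "sets \<mu> = sets borel"
    and null: "\<And>g. emeasure \<mu> {x. x - g \<in> B} = 0"
    using assms unfolding haar_null_def translate_eq_Collect by blast
  interpret \<mu>: prob_space \<mu> by fact
  note [measurable_cong] = \<mu>(2)
  obtain D :: "'a set" where D: "countable D" "\<And>U. open U \<Longrightarrow> U \<noteq> {} \<Longrightarrow> \<exists>d\<in>D. d \<in> U"
    using countable_dense_setE by blast
  have Vb: "{x. x - d \<in> V m} \<in> sets borel" for d using open_translate_V by (rule borel_open)
  have sp: "space \<mu> = UNIV" using sets_eq_imp_space_eq[OF \<mu>(2)] by simp
  have "\<exists>d\<in>D. emeasure \<mu> {x. x - d \<in> V m} \<noteq> 0"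
  proof (rule ccontr)
    assume "\<not> ?thesis"
    then have "(\<Union>d\<in>D. {x. x - d \<in> V m}) \<in> null_sets \<mu>"
      using D(1) Vb \<mu>(2) by (intro null_sets_UN') auto
    then have "emeasure \<mu> (\<Union>d\<in>D. {x. x - d \<in> V m}) = 0" by blast
    then show False using UN_translate_V[OF D(2), of m] \<mu>.emeasure_space_1 sp by simp
  qed
  then obtain d where d: "emeasure \<mu> {x. x - d \<in> V m} \<noteq> 0" by blast
  define A where "A = {x. x - d \<in> V m}"
  define M where "M = uniform_measure \<mu> A"
  \<comment> \<open>Off \<open>A\<close>, which is a null event for \<open>M\<close>, the value 0
    keeps \<open>f\<close> inside \<open>V m\<close> everywhere.\<close>
  define f where "f x = (if x \<in> A then x - d else 0)" for x
  have A[measurable]: "A \<in> sets borel" unfolding A_def by (rule Vb)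
  have [measurable]: "(\<lambda>x. x - d) \<in> borel_measurable borel" by (intro borel_measurable_group_diff) auto
  show thesis
  proof (rule that[of B M f])
    show "B \<in> sets borel" "X \<subseteq> B" by fact+
    show "prob_space M" unfolding M_def
      by (rule prob_space_uniform_measure) (use d in \<open>auto simp: A_def \<mu>.emeasure_eq_measure\<close>)
    show "sets M = sets borel" by (simp add: M_def \<mu>)
    show "f \<in> borel_measurable M" unfolding M_def f_def by measurable
    show "f x \<in> V m" for x by (auto simp: f_def A_def V_zero)
    fix g
    have fm: "f \<in> borel_measurable borel" unfolding f_def by measurable
    have m1: "{x. f x - g \<in> B} \<in> sets \<mu>"
      using measurable_sets[OF borel_measurable_group_diff[OF fm, of "\<lambda>_. g"] B(1)]
      by (simp add: vimage_def \<mu>)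
    have "A \<inter> {x. f x - g \<in> B} \<subseteq> {x. x - (d + g) \<in> B}" by (auto simp: f_def diff_diff_eq)
    then have "emeasure \<mu> (A \<inter> {x. f x - g \<in> B}) \<le> emeasure \<mu> {x. x - (d + g) \<in> B}"
      using borel_translate[OF B(1)] by (intro emeasure_mono) (auto simp: \<mu>)
    then have "emeasure \<mu> (A \<inter> {x. f x - g \<in> B}) = 0" using null[of "d + g"] by simp
    then show "emeasure M {x. f x - g \<in> B} = 0"
      unfolding M_def using m1 A by (subst emeasure_uniform_measure) (auto simp: \<mu>)
  qed
qed

text \<open>
  Christensen's theorem: the sum of independent witnesses, the \<open>n\<close>-th one concentrated on
  \<open>V (n + 2)\<close> so that the series converges, is a witness for all the sets at once.
\<close>

lemma haar_null_UN_aux: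
  fixes X :: "nat \<Rightarrow> 'a set"
  assumes "\<And>n. haar_null (X n)"
  shows "haar_null (\<Union>n. X n)"
proof -
  have "\<exists>B M (f::'a \<Rightarrow> 'a). B \<in> sets borel \<and> X n \<subseteq> B \<and> prob_space M \<and> sets M = sets borel \<and>
    f \<in> borel_measurable M \<and> (\<forall>x. f x \<in> V (n + 2)) \<and> (\<forall>g. emeasure M {x. f x - g \<in> B} = 0)" for n
    by (rule haar_null_witness_in_V[OF assms, of n "n + 2"]) blast
  then obtain B :: "nat \<Rightarrow> 'a set" and M :: "nat \<Rightarrow> 'a measure" and f :: "nat \<Rightarrow> 'a \<Rightarrow> 'a"
    where B: "\<And>n. B n \<in> sets borel" "\<And>n. X n \<subseteq> B n"
      and M: "\<And>n. prob_space (M n)" "\<And>n. sets (M n) = sets borel"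
      and f: "\<And>n. f n \<in> borel_measurable (M n)" "\<And>n x. f n x \<in> V (n + 2)"
      and null: "\<And>n g. emeasure (M n) {x. f n x - g \<in> B n} = 0"
    by metis
  note [measurable_cong] = M(2)
  note [measurable] = f(1)
  define S where "S \<omega> = (\<Sum>i. f i (\<omega> i))" for \<omega>
  define P where "P = PiM UNIV M"
  define \<mu> where "\<mu> = distr P borel S"
  have summable: "summable (\<lambda>i. if i \<in> I then f i (\<omega> i) else 0)" for \<omega> I
    by (rule suminf_in_V(1)[of _ 0]) (use f(2) V_zero in auto)
  have S_meas[measurable]: "S \<in> borel_measurable P"
  proof (rule borel_measurable_LIMSEQ_metric)
    show "(\<lambda>\<omega>. \<Sum>i<n. f i (\<omega> i)) \<in> borel_measurable P" for n unfolding P_def by measurable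
    show "(\<lambda>n. \<Sum>i<n. f i (\<omega> i)) \<longlonglongrightarrow> S \<omega>" for \<omega>
      unfolding S_def using summable_LIMSEQ[OF summable[of UNIV \<omega>]] by simp
  qed
  interpret P: prob_space P unfolding P_def by (intro prob_space_PiM M)
  \<comment> \<open>Fubini: once all coordinates but the \<open>n\<close>-th are frozen,
    \<open>S\<close> is \<open>f n x\<close> plus a constant, and \<open>f n\<close> avoids each
    given translate of \<open>B n\<close> almost surely.\<close>
  have null_n: "emeasure \<mu> {x. x - g \<in> B n} = 0" for n g
  proof -
    define I where "I = UNIV - {n}"
    define R where "R \<omega> = (\<Sum>i. if i \<in> I then f i (\<omega> i) else 0)" for \<omega>
    have split: "S (fun_upd \<omega> n x) = R \<omega> + f n x" for \<omega> x
    proof -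
      have "(\<lambda>i. (if i \<in> I then f i (\<omega> i) else 0) + (if i = n then f n x else 0)) sums (R \<omega> + f n x)"
        unfolding R_def by (intro sums_add summable_sums summable sums_single)
      moreover have "(if i \<in> I then f i (\<omega> i) else 0) + (if i = n then f n x else 0) = f i (fun_upd \<omega> n x i)" for i
        by (auto simp: I_def)
      ultimately show ?thesis unfolding S_def by (simp add: sums_iff)
    qed
    interpret M: prob_space "M n" by (rule M)
    interpret PI: prob_space "PiM I M" by (intro prob_space_PiM M)
    interpret pair_sigma_finite "M n" "PiM I M" ..
    have P_eq: "P = distr (M n \<Otimes>\<^sub>M PiM I M) P (\<lambda>(x, \<omega>). fun_upd \<omega> n x)"
    proof -
      have "insert n I = UNIV" by (auto simp: I_def)
      then show ?thesis
        using distr_pair_PiM_eq_PiM[of I M n] M(1) by (simp add: P_def)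
    qed
    have upd[measurable]: "(\<lambda>(x, \<omega>). fun_upd \<omega> n x) \<in> M n \<Otimes>\<^sub>M PiM I M \<rightarrow>\<^sub>M P"
      unfolding P_def case_prod_beta by (rule measurable_fun_upd[where J=I]) (auto simp: I_def)
    define A where "A = {x. x - g \<in> B n}"
    have A[measurable]: "A \<in> sets borel" unfolding A_def by (rule borel_translate[OF B(1)])
    have "emeasure \<mu> A = emeasure P (S -` A \<inter> space P)"
      unfolding \<mu>_def by (rule emeasure_distr) auto
    also have "\<dots> = emeasure (M n \<Otimes>\<^sub>M PiM I M)
        ((\<lambda>(x, \<omega>). fun_upd \<omega> n x) -` (S -` A \<inter> space P) \<inter> space (M n \<Otimes>\<^sub>M PiM I M))" (is "_ = emeasure _ ?C")
      by (subst P_eq) (rule emeasure_distr, auto)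
    also have "\<dots> = (\<integral>\<^sup>+\<omega>. emeasure (M n) ((\<lambda>x. (x, \<omega>)) -` ?C) \<partial>PiM I M)"
      by (rule emeasure_pair_measure_alt2) measurable
    also have "\<dots> = (\<integral>\<^sup>+\<omega>. 0 \<partial>PiM I M)"
    proof (rule nn_integral_cong)
      fix \<omega>
      have "(\<lambda>x. (x, \<omega>)) -` ?C \<subseteq> {x. f n x - (g - R \<omega>) \<in> B n}"
        by (auto simp: A_def split algebra_simps)
      moreover have "{x. f n x - (g - R \<omega>) \<in> B n} \<in> sets (M n)"
        using measurable_sets[OF borel_measurable_group_diff[OF f(1), of "\<lambda>_. g - R \<omega>"] B(1), of n n]
          sets_eq_imp_space_eq[OF M(2)] by (simp add: vimage_def)
      ultimately have "emeasure (M n) ((\<lambda>x. (x, \<omega>)) -` ?C) \<le> emeasure (M n) {x. f n x - (g - R \<omega>) \<in> B n}"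
        by (rule emeasure_mono)
      then show "emeasure (M n) ((\<lambda>x. (x, \<omega>)) -` ?C) = 0" using null by simp
    qed
    finally show ?thesis by (simp add: A_def)
  qed
  show ?thesis
    unfolding haar_null_def translate_eq_Collect
  proof (intro exI conjI allI)
    show "(\<Union>n. B n) \<in> sets borel" using B(1) by auto
    show "(\<Union>n. X n) \<subseteq> (\<Union>n. B n)" using B(2) by blast
    show "prob_space \<mu>" unfolding \<mu>_def by (rule P.prob_space_distr) measurable
    show "sets \<mu> = sets borel" by (simp add: \<mu>_def)
    fix g
    have "emeasure \<mu> (\<Union>n. {x. x - g \<in> B n}) = 0"
      using null_n borel_translate[OF B(1)] by (intro emeasure_UN_eq_0) (auto simp: \<mu>_def)
    moreover have "{x. x - g \<in> (\<Union>n. B n)} = (\<Union>n. {x. x - g \<in> B n})" by auto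
    ultimately show "emeasure \<mu> {x. x - g \<in> (\<Union>n. B n)} = 0" by simp
  qed
qed

end

lemma haar_null_UN:
  fixes X :: "nat \<Rightarrow> 'a::{polish_space, topological_ab_group_add} set"
  assumes "\<And>n. haar_null (X n)"
  shows "haar_null (\<Union>n. X n)"
proof -
  obtain V :: "nat \<Rightarrow> 'a set" where "zero_nbhd_base V" using exists_zero_nbhd_base by blast
  then interpret zero_nbhd_base V .
  interpret polish_zero_nbhd_base V ..
  show ?thesis by (rule haar_null_UN_aux) (rule assms)
qed

lemma haar_null_countable_Union:
  fixes A :: "'a::{polish_space, topological_ab_group_add} set set"
  assumes "countable A" "\<And>X. X \<in> A \<Longrightarrow> haar_null X"
  shows "haar_null (\<Union>A)"
proof (cases "A = {}")
  case False
  then have "A = range (from_nat_into A)" using assms(1) by (simp add: range_from_nat_into)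
  moreover have "haar_null (\<Union>n. from_nat_into A n)"
    using False by (intro haar_null_UN assms(2) from_nat_into)
  ultimately show ?thesis by simp
qed (simp add: haar_null_empty)

section \<open>Translations that keep compact sets apart\<close>

abbreviation nat_seq :: "(nat \<Rightarrow> nat) measure" where
  "nat_seq \<equiv> PiM UNIV (\<lambda>_. count_space UNIV)"

abbreviation bool_seq :: "(nat \<Rightarrow> bool) measure" where
  "bool_seq \<equiv> PiM UNIV (\<lambda>_. count_space UNIV)"

text \<open>
  Digits at position \<open>n\<close> are taken from \<open>V (m n)\<close>, which finitely many translates of \<open>V (J n)\<close>
  cannot cover, so that each \<open>g n k\<close> can be chosen to avoid finitely many such translates.
  The gap \<open>m (Suc n) = J n + 10\<close> makes all later digits negligible compared with \<open>V (J n)\<close>.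
\<close>

locale digit_scheme = polish_zero_nbhd_base V
  for V :: "nat \<Rightarrow> 'a::{polish_space, topological_ab_group_add} set" +
  fixes m J :: "nat \<Rightarrow> nat" and c d :: "nat \<Rightarrow> 'a" and g :: "nat \<Rightarrow> nat \<Rightarrow> 'a"
  assumes m_Suc: "m (Suc n) = J n + 10"
    and m_le_J: "m n \<le> J n"
    and c_in: "c n \<in> V (m n)"
    and c_notin: "c n \<notin> V (J n)"
    and g_in: "g n k \<in> V (m n)"
    and g_separated: "j < k \<Longrightarrow> i \<le> j \<Longrightarrow> i' \<le> k \<Longrightarrow> S \<subseteq> {..n} \<Longrightarrow> S' \<subseteq> {..n} \<Longrightarrow>
      (g n k + (d i' - sum c S')) - (g n j + (d i - sum c S)) \<notin> V (J n)"
    and d_dense: "open U \<Longrightarrow> U \<noteq> {} \<Longrightarrow> \<exists>i. d i \<in> U"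
begin

lemma m_add_le: "m n + i \<le> m (n + i)"
proof (induction i)
  case (Suc i)
  then show ?case using m_le_J[of "n + i"] by (simp add: m_Suc)
qed simp

text \<open>The terms after position \<open>n\<close> start in \<open>V (J n + 10)\<close> and
  descend at least one level each; summing them costs two levels, whence
  \<open>J n + 8\<close>.\<close>

lemma series_tail:
  assumes x: "\<And>i. x i \<in> V (m i)"
  shows "summable x" "suminf x - (\<Sum>i<Suc n. x i) \<in> V (J n + 8)"
proof -
  let ?y = "\<lambda>n i. x (i + Suc n)"
  have y: "?y n i \<in> V (Suc (Suc (J n + 8)) + i)" for n i
    using x[of "i + Suc n"] V_decseq[of "J n + 10 + i" "m (Suc n + i)"] m_add_le[of "Suc n" i]
    by (auto simp: m_Suc ac_simps)
  have "summable (?y n)" for n by (rule suminf_in_V(1)[OF y])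
  then have "(\<lambda>k. \<Sum>i<k. ?y n i) \<longlonglongrightarrow> suminf (?y n)" for n by (rule summable_LIMSEQ)
  then have "(\<lambda>k. (\<Sum>i<Suc n. x i) + (\<Sum>i<k. ?y n i)) \<longlonglongrightarrow> (\<Sum>i<Suc n. x i) + suminf (?y n)" for n
    by (intro tendsto_intros)
  moreover have "(\<Sum>i<Suc n. x i) + (\<Sum>i<k. ?y n i) = (\<Sum>i<k + Suc n. x i)" for k n
    by (induction k) (auto simp: ac_simps)
  ultimately have "(\<lambda>k. \<Sum>i<k + Suc n. x i) \<longlonglongrightarrow> (\<Sum>i<Suc n. x i) + suminf (?y n)" for n
    by simp
  then have sums: "x sums ((\<Sum>i<Suc n. x i) + suminf (?y n))" for n
    unfolding sums_def by (rule LIMSEQ_offset)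
  then show "summable x" by (rule sums_summable)
  have "suminf x - (\<Sum>i<Suc n. x i) = suminf (?y n)"
    unfolding sums_unique[OF sums[of n], symmetric] by simp
  then show "suminf x - (\<Sum>i<Suc n. x i) \<in> V (J n + 8)"
    using suminf_in_V(2)[OF y, of n] by simp
qed

text \<open>Parametrizes the Cantor set \<open>C\<close> by bits. As \<open>c n\<close> lies outside
  \<open>V (J n)\<close>, bit \<open>n\<close> is not blurred by the later ones.\<close>

definition cantor :: "(nat \<Rightarrow> bool) \<Rightarrow> 'a" where
  "cantor e = (\<Sum>i. if e i then c i else 0)"

definition shift :: "(nat \<Rightarrow> nat) \<Rightarrow> 'a" where
  "shift k = (\<Sum>i. g i (k i))"

text \<open>\<open>K k\<close> is the intersection of all \<open>covered n (k n)\<close>. The index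
  \<open>m (Suc n) = J n + 10\<close> makes the approximation by \<open>d i\<close> finer than
  \<open>V (J n)\<close>.\<close>

definition covered :: "nat \<Rightarrow> nat \<Rightarrow> 'a set" where
  "covered n j = (\<Union>i\<le>j. {p. p - d i \<in> V (m (Suc n))})"

text \<open>Holds all points \<open>p - cantor e + shift k'\<close> with \<open>p\<close> in
  \<open>covered n k\<close> whose index \<open>k'\<close> starts with the \<open>n\<close> digits
  \<open>s\<close> followed by \<open>k\<close>. \<open>S\<close> stands for the bits of
  \<open>e\<close> up to \<open>n\<close> and \<open>d i\<close> for \<open>p\<close>;
  \<open>V (J n + 6)\<close> absorbs three errors, each in \<open>V (J n + 8)\<close>.\<close>

definition cell :: "nat \<Rightarrow> nat list \<Rightarrow> nat \<Rightarrow> 'a set" where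
  "cell n s k = (\<Union>i\<le>k. \<Union>S\<in>Pow {..n}. {x. x - ((\<Sum>i<n. g i (s ! i)) + g n k + (d i - sum c S)) \<in> V (J n + 6)})"

text \<open>The centres of the cells contain the earlier digits, so decoding is recursive. Where no
  cell contains \<open>x\<close>, \<open>LEAST\<close> gives some fixed value and decoding stays
  total.\<close>

primrec prefix :: "'a \<Rightarrow> nat \<Rightarrow> nat list" where
  "prefix x 0 = []"
| "prefix x (Suc n) = prefix x n @ [LEAST k. x \<in> cell n (prefix x n) k]"

definition decode :: "'a \<Rightarrow> nat \<Rightarrow> nat" where
  "decode x n = (LEAST k. x \<in> cell n (prefix x n) k)"

lemma cantor_term_in: "(if e i then c i else 0) \<in> V (m i)"
  by (simp add: c_in V_zero)

lemma cantor_measurable [measurable]: "cantor \<in> borel_measurable bool_seq"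
proof (rule borel_measurable_LIMSEQ_metric)
  show "(\<lambda>e. \<Sum>i<n. if e i then c i else 0) \<in> borel_measurable bool_seq" for n by measurable
  show "(\<lambda>n. \<Sum>i<n. if e i then c i else 0) \<longlonglongrightarrow> cantor e" for e
    unfolding cantor_def by (intro summable_LIMSEQ series_tail(1) cantor_term_in)
qed

lemma shift_measurable [measurable]: "shift \<in> borel_measurable nat_seq"
proof (rule borel_measurable_LIMSEQ_metric)
  have "(\<lambda>k. g i (k i)) \<in> borel_measurable nat_seq" for i
    by (rule measurable_compose[OF measurable_component_singleton]) auto
  then show "(\<lambda>k. \<Sum>i<n. g i (k i)) \<in> borel_measurable nat_seq" for n
    by (intro borel_measurable_sum)
  show "(\<lambda>n. \<Sum>i<n. g i (k i)) \<longlonglongrightarrow> shift k" for k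
    unfolding shift_def by (intro summable_LIMSEQ series_tail(1) g_in)
qed

text \<open>At the first differing bit, equality makes \<open>c n\<close> or \<open>- c n\<close> a
  difference of two tails, hence an element of \<open>V (J n)\<close>, contrary to
  \<open>c_notin\<close>.\<close>

lemma cantor_inj: "inj cantor"
proof (rule injI, rule ccontr)
  fix e e' assume eq: "cantor e = cantor e'" and "e \<noteq> e'"
  then have "\<exists>n. e n \<noteq> e' n" by auto
  define n where "n = (LEAST n. e n \<noteq> e' n)"
  have n: "e n \<noteq> e' n" unfolding n_def using \<open>\<exists>n. e n \<noteq> e' n\<close> by (rule LeastI_ex)
  have less: "e i = e' i" if "i < n" for i using not_less_Least that unfolding n_def by blast
  let ?s = "\<lambda>e n. \<Sum>i<n. if e i then c i else 0"
  have tail: "cantor e - ?s e (Suc n) \<in> V (J n + 8)" for e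
    unfolding cantor_def by (rule series_tail(2)) (rule cantor_term_in)
  have "(cantor e - ?s e (Suc n)) - (cantor e' - ?s e' (Suc n)) \<in> V (J n)"
    by (rule V_diff_less[OF tail tail]) auto
  moreover have "?s e n = ?s e' n" using less by (intro sum.cong) auto
  ultimately have "(if e' n then c n else 0) - (if e n then c n else 0) \<in> V (J n)"
    by (simp add: eq algebra_simps)
  then have "c n \<in> V (J n) \<or> - c n \<in> V (J n)" using n by (auto split: if_splits)
  then show False using c_notin[of n] V_uminus[of "- c n" "J n"] by auto
qed

text \<open>A common point would put the difference of two centres into \<open>V (J n)\<close>; the
  earlier digits cancel and \<open>g_separated\<close> excludes the rest.\<close>

lemma cell_disjoint:
  assumes "x \<in> cell n s j" "x \<in> cell n s k"
  shows "j = k"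
proof -
  have False if less: "j < k" and x: "x \<in> cell n s j" "x \<in> cell n s k" for j k
  proof -
    let ?a = "\<Sum>i<n. g i (s ! i)"
    obtain i S where iS: "i \<le> j" "S \<subseteq> {..n}" "x - (?a + g n j + (d i - sum c S)) \<in> V (J n + 6)"
      using x(1) unfolding cell_def by blast
    obtain i' S' where iS': "i' \<le> k" "S' \<subseteq> {..n}" "x - (?a + g n k + (d i' - sum c S')) \<in> V (J n + 6)"
      using x(2) unfolding cell_def by blast
    have "(x - (?a + g n j + (d i - sum c S))) - (x - (?a + g n k + (d i' - sum c S'))) \<in> V (J n)"
      by (rule V_diff_less[OF iS(3) iS'(3)]) auto
    moreover have "(x - (?a + g n j + (d i - sum c S))) - (x - (?a + g n k + (d i' - sum c S')))
       = (g n k + (d i' - sum c S')) - (g n j + (d i - sum c S))" by (simp add: algebra_simps)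
    ultimately have "(g n k + (d i' - sum c S')) - (g n j + (d i - sum c S)) \<in> V (J n)"
      by simp
    then show False using g_separated[OF less iS(1) iS'(1) iS(2) iS'(2)] by contradiction
  qed
  then show ?thesis using assms by (metis linorder_neqE_nat)
qed

lemma open_cell: "open (cell n s k)"
  unfolding cell_def by (intro open_UN ballI open_translate_V)

lemma prefix_measurable: "(\<lambda>x. prefix x n) \<in> borel \<rightarrow>\<^sub>M count_space UNIV"
proof (induction n)
  case (Suc n)
  have "(\<lambda>x. s @ [LEAST k. x \<in> cell n s k]) \<in> borel \<rightarrow>\<^sub>M count_space UNIV" for s
  proof -
    have [measurable]: "cell n s k \<in> sets borel" for k using open_cell by (rule borel_open)
    show ?thesis by measurable
  qed
  from measurable_compose_countable[OF this Suc] show ?case by simp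
qed simp

lemma decode_measurable: "(\<lambda>x. decode x n) \<in> borel \<rightarrow>\<^sub>M count_space UNIV"
proof -
  have "(\<lambda>x. LEAST k. x \<in> cell n s k) \<in> borel \<rightarrow>\<^sub>M count_space UNIV" for s
  proof -
    have [measurable]: "cell n s k \<in> sets borel" for k using open_cell by (rule borel_open)
    show ?thesis by measurable
  qed
  from measurable_compose_countable[OF this prefix_measurable] show ?thesis by (simp add: decode_def)
qed

text \<open>Once the digits before \<open>n\<close> are known, the point lies in the cell of
  \<open>k n\<close> and, by disjointness, in no other. The answer is the same for every
  \<open>e\<close>, so the sets \<open>K k + t k - C\<close> are disjoint for distinct
  \<open>k\<close>.\<close>

lemma decode_eq:
  assumes p: "\<And>n. p \<in> covered n (k n)"
  shows "decode (p - cantor e + shift k) = k"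
proof -
  define x where "x = p - cantor e + shift k"
  have cell: "x \<in> cell n (map k [0..<n]) (k n)" for n
  proof -
    obtain i where i: "i \<le> k n" "p - d i \<in> V (m (Suc n))" using p[of n] by (auto simp: covered_def)
    define S where "S = {i\<in>{..n}. e i}"
    have S: "sum c S = (\<Sum>i<Suc n. if e i then c i else 0)"
      unfolding S_def by (subst sum.inter_filter) (auto simp: lessThan_Suc_atMost)
    have 1: "p - d i \<in> V (J n + 8)" using i(2) V_decseq[of "J n + 8" "J n + 10"] by (auto simp: m_Suc)
    have 2: "cantor e - sum c S \<in> V (J n + 8)"
      unfolding cantor_def S by (rule series_tail(2)) (rule cantor_term_in)
    have 3: "shift k - (\<Sum>i<Suc n. g i (k i)) \<in> V (J n + 8)"
      unfolding shift_def by (rule series_tail(2)) (rule g_in)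
    have "(p - d i) + (shift k - (\<Sum>i<Suc n. g i (k i))) \<in> V (J n + 7)" 
      by (rule V_add_less[OF 1 3]) auto
    then have "((p - d i) + (shift k - (\<Sum>i<Suc n. g i (k i)))) - (cantor e - sum c S) \<in> V (J n + 6)"
      by (rule V_diff_less[OF _ 2]) auto
    moreover have "(\<Sum>i<n. g i (map k [0..<n] ! i)) = (\<Sum>i<n. g i (k i))" by (rule sum.cong) auto
    ultimately have "x - ((\<Sum>i<n. g i (map k [0..<n] ! i)) + g n (k n) + (d i - sum c S)) \<in> V (J n + 6)"
      by (simp add: x_def algebra_simps)
    moreover have "S \<in> Pow {..n}" by (auto simp: S_def)
    ultimately show ?thesis unfolding cell_def using i(1) by blast
  qed
  have least: "(LEAST j. x \<in> cell n (map k [0..<n]) j) = k n" for n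
    using cell[of n] cell_disjoint by (intro Least_equality) (auto dest: cell_disjoint)
  have "prefix x n = map k [0..<n]" for n
    by (induction n) (auto simp: least)
  then show ?thesis by (auto simp: decode_def least x_def[symmetric])
qed

lemma open_covered: "open (covered n j)"
  unfolding covered_def by (intro open_UN ballI open_translate_V)

lemma covered_mono: "i \<le> j \<Longrightarrow> covered n i \<subseteq> covered n j"
  unfolding covered_def by (intro UN_mono) auto

lemma compact_covered:
  assumes "compact L" shows "\<exists>a. L \<subseteq> covered n a"
proof -
  have "(\<Union>p\<in>range d. {x. x - p \<in> V (m (Suc n))}) = UNIV"
    by (rule UN_translate_V) (use d_dense in auto)
  then have "L \<subseteq> (\<Union>i\<in>UNIV. {p. p - d i \<in> V (m (Suc n))})" by auto
  then obtain I where "finite I" "L \<subseteq> (\<Union>i\<in>I. {p. p - d i \<in> V (m (Suc n))})"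
    using compactE_image[OF assms, of UNIV "\<lambda>i. {p. p - d i \<in> V (m (Suc n))}"] open_translate_V by metis
  moreover then have "I \<subseteq> {..Max I}" by auto
  ultimately have "L \<subseteq> covered n (Max I)" unfolding covered_def by blast
  then show ?thesis ..
qed

end

section \<open>Existence of the digits when local compactness fails\<close>

context polish_zero_nbhd_base
begin

text \<open>\<open>J n\<close> is a scale at which \<open>V (m n)\<close> has no finite cover, so
  the digits \<open>g n k\<close> can be chosen one after another, each avoiding finitely many
  translates of \<open>V (J n)\<close>.\<close>

lemma exists_digit_scheme:
  assumes nlc: "\<not> locally_compact_space (euclidean :: 'a topology)"
  shows "\<exists>m J c d g. digit_scheme V m J c d g"
proof -
  have "\<exists>k\<ge>n. \<forall>F. finite F \<longrightarrow> \<not> V n \<subseteq> (\<Union>f\<in>F. {x. x - f \<in> V k})" for n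
  proof -
    obtain k where k: "\<forall>F. finite F \<longrightarrow> \<not> V n \<subseteq> (\<Union>f\<in>F. {x. x - f \<in> V k})"
      using V_not_totally_bounded[OF nlc] by blast
    have "(\<Union>f\<in>F. {x. x - f \<in> V (max n k)}) \<subseteq> (\<Union>f\<in>F. {x. x - f \<in> V k})" for F
      using V_decseq[of k "max n k"] by auto
    then have "\<forall>F. finite F \<longrightarrow> \<not> V n \<subseteq> (\<Union>f\<in>F. {x. x - f \<in> V (max n k)})"
      using k by (meson order_trans)
    then show ?thesis by (metis max.cobounded1)
  qed
  then obtain M where M: "\<And>n. n \<le> M n" "\<And>n F. finite F \<Longrightarrow> \<not> V n \<subseteq> (\<Union>f\<in>F. {x. x - f \<in> V (M n)})"
    by metis
  define m where "m = rec_nat 0 (\<lambda>_ k. M k + 10)"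
  define J where "J n = M (m n)" for n
  have avoid: "\<exists>x\<in>V (m n). \<forall>f\<in>F. x - f \<notin> V (J n)" if "finite F" for F n
    using M(2)[OF that, of "m n"] by (auto simp: J_def)
  have "\<exists>x. x \<in> V (m n) \<and> x \<notin> V (J n)" for n using avoid[of "{0}" n] by auto
  then obtain c where c: "\<And>n. c n \<in> V (m n)" "\<And>n. c n \<notin> V (J n)" by metis
  obtain d :: "nat \<Rightarrow> 'a" where d: "\<And>U. open U \<Longrightarrow> U \<noteq> {} \<Longrightarrow> \<exists>i. d i \<in> U"
    by (rule exists_dense_sequence) (rule that)
  let ?P = "\<lambda>n f k r. r \<in> V (m n) \<and> (\<forall>j<k. \<forall>i\<le>j. \<forall>i'\<le>k. \<forall>S\<in>Pow {..n}. \<forall>S'\<in>Pow {..n}.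
    (r + (d i' - sum c S')) - (f j + (d i - sum c S)) \<notin> V (J n))"
  have "\<exists>f. \<forall>k. ?P n f k (f k)" for n
  proof (rule dependent_wellorder_choice)
    show "?P n f x r = ?P n g x r" if "\<And>y. y < x \<Longrightarrow> f y = g y" for r f g x using that by auto
    fix k f
    \<comment> \<open>The forbidden centres, obtained by solving the relation in
      \<open>g_separated\<close> for the new digit; all parameters range over finite sets.\<close>
    define F where "F = (\<lambda>(j, i, i', S, S'). f j + (d i - sum c S) - (d i' - sum c S')) `
      ({..<k} \<times> {..k} \<times> {..k} \<times> Pow {..n} \<times> Pow {..n})"
    have "finite F" unfolding F_def by auto
    then obtain x where x: "x \<in> V (m n)" "\<And>f. f \<in> F \<Longrightarrow> x - f \<notin> V (J n)" using avoid by metis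
    have "(x + (d i' - sum c S')) - (f j + (d i - sum c S)) \<notin> V (J n)"
      if "j < k" "i \<le> j" "i' \<le> k" "S \<in> Pow {..n}" "S' \<in> Pow {..n}" for i i' j S S'
    proof -
      have "f j + (d i - sum c S) - (d i' - sum c S') \<in> F"
        unfolding F_def by (rule image_eqI[of _ _ "(j, i, i', S, S')"]) (use that in auto)
      from x(2)[OF this] show ?thesis by (simp add: algebra_simps)
    qed
    with x(1) have "?P n f k x" by blast
    then show "\<exists>r. ?P n f k r" by (rule exI)
  qed
  then have "\<forall>n. \<exists>f. \<forall>k. ?P n f k (f k)" by (rule allI)
  from choice[OF this] obtain g where g': "\<forall>n k. ?P n (g n) k (g n k)" by (elim exE)
  have g: "?P n (g n) k (g n k)" for n k using g' by simp
  have "digit_scheme V m J c d g"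
  proof
    show "m (Suc n) = J n + 10" for n by (simp add: m_def J_def)
    show "m n \<le> J n" for n unfolding J_def by (rule M)
    show "g n k \<in> V (m n)" for n k using g[of n k] by blast
    show "(g n k + (d i' - sum c S')) - (g n j + (d i - sum c S)) \<notin> V (J n)"
      if "j < k" "i \<le> j" "i' \<le> k" "S \<subseteq> {..n}" "S' \<subseteq> {..n}" for i i' j k n S S'
      using g[of n k] that by blast
  qed (use c d in auto)
  then show ?thesis by blast
qed

end

section \<open>Universal families of Borel sets and functions\<close>

text \<open>\<open>y\<close> is a Borel code: \<open>y 0 = 0\<close> announces the basic open set
  with index \<open>y 1\<close>. Otherwise the entries at \<open>(n, 0)\<close> and
  \<open>(n, Suc m)\<close> give the level and the code of the \<open>n\<close>-th set of the union.
  Quantifying over \<open>k\<close> keeps each \<open>U (e \<xi> k)\<close> at a fixed level, which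
  makes measurability visible.\<close>

definition universal_step ::
    "'i rel \<Rightarrow> ('i \<Rightarrow> nat \<Rightarrow> 'i) \<Rightarrow> (nat \<Rightarrow> 'a set) \<Rightarrow> ('i \<Rightarrow> ((nat \<Rightarrow> nat) \<times> 'a) set) \<Rightarrow> 'i \<Rightarrow> ((nat \<Rightarrow> nat) \<times> 'a) set" where
  "universal_step R e b U \<xi> = {(y, x). if y 0 = 0 then x \<in> b (y 1)
     else \<forall>n k. y (Suc (prod_encode (n, 0))) = k \<longrightarrow> (e \<xi> k, \<xi>) \<in> R \<longrightarrow>
       ((\<lambda>m. y (Suc (prod_encode (n, Suc m)))), x) \<notin> U (e \<xi> k)}"

text \<open>
  A section of \<open>U \<xi>\<close> is either a basic open set or the complement of a countable union of
  sections of lower levels; along \<open>\<omega>\<^sub>1\<close> this exhausts all Borel sets, although each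
  single \<open>U \<xi>\<close> is Borel.
\<close>

lemma exists_universal_borel_sets:
  fixes R :: "'i rel" and Z :: "'i set"
  assumes wf: "wf R" and count: "\<And>\<xi>. countable {\<eta>. (\<eta>, \<xi>) \<in> R}" and Z: "Z \<noteq> {}"
    and bounded: "\<And>s :: nat \<Rightarrow> 'i. range s \<subseteq> Z \<Longrightarrow> \<exists>\<zeta>\<in>Z. \<forall>n. (s n, \<zeta>) \<in> R"
  obtains U :: "'i \<Rightarrow> ((nat \<Rightarrow> nat) \<times> 'a::second_countable_topology) set"
  where "\<And>\<xi>. U \<xi> \<in> sets (nat_seq \<Otimes>\<^sub>M borel)"
    and "\<And>A :: nat \<Rightarrow> 'a set. range A \<subseteq> sets borel \<Longrightarrow> \<exists>\<xi>\<in>Z. \<forall>n. \<exists>y. A n = {x. (y, x) \<in> U \<xi>}"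
proof -
  obtain \<B> :: "'a set set" where \<B>: "countable \<B>" "topological_basis \<B>"
    using ex_countable_basis by blast
  define b where "b = from_nat_into (insert {} \<B>)"
  have range_b: "range b = insert {} \<B>" unfolding b_def using \<B>(1) by (intro range_from_nat_into) auto
  \<comment> \<open>At a minimal \<open>\<xi>\<close> there are no predecessors and the values of
    \<open>e \<xi>\<close> are arbitrary, hence the guard in \<open>universal_step\<close>.\<close>
  define e where "e \<xi> = from_nat_into {\<eta>. (\<eta>, \<xi>) \<in> R}" for \<xi>
  have range_e: "\<exists>k. e \<xi> k = \<eta>" if "(\<eta>, \<xi>) \<in> R" for \<eta> \<xi>
    unfolding e_def using that by (intro from_nat_into_surj count) simp
  define U where "U = wfrec R (universal_step R e b)"
  have "U \<xi> = universal_step R e b (cut U R \<xi>) \<xi>" for \<xi>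
    unfolding U_def by (rule wfrec[OF wf])
  also have "universal_step R e b (cut U R \<xi>) \<xi> = universal_step R e b U \<xi>" for \<xi>
    unfolding universal_step_def by (auto simp: cut_apply)
  finally have U: "U \<xi> = universal_step R e b U \<xi>" for \<xi> .
  define \<Gamma> where "\<Gamma> \<xi> = {A. \<exists>y. A = {x. (y, x) \<in> U \<xi>}}" for \<xi>
  have meas: "U \<xi> \<in> sets (nat_seq \<Otimes>\<^sub>M borel)" for \<xi>
    using wf
  proof (induction \<xi> rule: wf_induct_rule)
    case (less \<xi>)
    have b_meas: "b i \<in> sets borel" for i
      using range_b topological_basis_open[OF \<B>(2)] by (metis borel_open insertE open_empty rangeI)
    have comp: "(\<lambda>p. (fst p :: nat \<Rightarrow> nat) j) \<in> nat_seq \<Otimes>\<^sub>M (borel :: 'a measure) \<rightarrow>\<^sub>M count_space UNIV" for j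
      by measurable
    have basic: "{p \<in> space (nat_seq \<Otimes>\<^sub>M borel). snd p \<in> b ((fst p :: nat \<Rightarrow> nat) 1)} \<in> sets (nat_seq \<Otimes>\<^sub>M borel)"
    proof -
      have "(\<lambda>p. snd p \<in> b ((fst p :: nat \<Rightarrow> nat) 1)) \<in> nat_seq \<Otimes>\<^sub>M borel \<rightarrow>\<^sub>M count_space UNIV"
        by (rule measurable_compose_countable[OF _ comp]) (use b_meas in measurable)
      then show ?thesis by measurable
    qed
    have rec: "{p \<in> space (nat_seq \<Otimes>\<^sub>M borel). ((\<lambda>m. fst p (Suc (prod_encode (n, Suc m)))), snd p) \<in> U (e \<xi> k)}
      \<in> sets (nat_seq \<Otimes>\<^sub>M borel)" if "(e \<xi> k, \<xi>) \<in> R" for n k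
    proof -
      have "(\<lambda>p :: (nat \<Rightarrow> nat) \<times> 'a. ((\<lambda>m. fst p (Suc (prod_encode (n, Suc m)))), snd p))
        \<in> nat_seq \<Otimes>\<^sub>M borel \<rightarrow>\<^sub>M nat_seq \<Otimes>\<^sub>M borel"
        by (intro measurable_Pair measurable_PiM_single' comp) auto
      from measurable_sets[OF this less[OF that]] show ?thesis
        by (simp add: vimage_def Int_def conj_commute)
    qed
    have rec': "Measurable.pred (nat_seq \<Otimes>\<^sub>M borel) (\<lambda>p. (e \<xi> k, \<xi>) \<in> R \<longrightarrow>
        ((\<lambda>m. fst p (Suc (prod_encode (n, Suc m)))), snd p) \<notin> U (e \<xi> k))" for n k
      using rec[of k n] by (cases "(e \<xi> k, \<xi>) \<in> R") (simp_all add: pred_def[symmetric])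
    have comp': "Measurable.pred (nat_seq \<Otimes>\<^sub>M borel) (\<lambda>p :: (nat \<Rightarrow> nat) \<times> 'a. fst p j = k)" for j k
      by measurable
    have rec_all: "Measurable.pred (nat_seq \<Otimes>\<^sub>M borel) (\<lambda>p. \<forall>n k. fst p (Suc (prod_encode (n, 0))) = k \<longrightarrow>
        (e \<xi> k, \<xi>) \<in> R \<longrightarrow> ((\<lambda>m. fst p (Suc (prod_encode (n, Suc m)))), snd p) \<notin> U (e \<xi> k))"
      by (intro pred_intros_countable(1) pred_intros_logic(4) comp' rec')
    have "Measurable.pred (nat_seq \<Otimes>\<^sub>M borel) (\<lambda>p. p \<in> U \<xi>)"
      unfolding U[of \<xi>] universal_step_def mem_Collect_eq case_prod_beta
      by (intro measurable_If rec_all) (use basic comp'[of 0 0] in \<open>simp_all add: pred_def\<close>)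
    then show ?case by (simp add: pred_def space_pair_measure space_PiM)
  qed
  have basicI: "b i \<in> \<Gamma> \<xi>" for i \<xi>
    unfolding \<Gamma>_def U[of \<xi>] universal_step_def by (auto intro!: exI[of _ "\<lambda>j. if j = 0 then 0 else i"])
  have stepI: "- (\<Union>n. A n) \<in> \<Gamma> \<zeta>" if A: "\<And>n. A n \<in> \<Gamma> (s n)" "\<And>n. (s n, \<zeta>) \<in> R"
    for A :: "nat \<Rightarrow> 'a set" and s \<zeta>
  proof -
    have "\<forall>n. \<exists>k. e \<zeta> k = s n" using range_e A(2) by blast
    then obtain k where k: "\<And>n. e \<zeta> (k n) = s n" by metis
    have "\<forall>n. \<exists>y. A n = {x. (y, x) \<in> U (s n)}" using A(1) unfolding \<Gamma>_def by simp
    from choice[OF this] obtain z where z: "\<And>n. A n = {x. (z n, x) \<in> U (s n)}" by blast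
    define y where "y j = (case j of 0 \<Rightarrow> 1 | Suc i \<Rightarrow>
      (case prod_decode i of (n, 0) \<Rightarrow> k n | (n, Suc m) \<Rightarrow> z n m))" for j
    have y: "y 0 \<noteq> 0" "y (Suc (prod_encode (n, 0))) = k n" "y (Suc (prod_encode (n, Suc m))) = z n m" for n m
      by (auto simp: y_def)
    have "{x. (y, x) \<in> U \<zeta>} = - (\<Union>n. A n)"
      unfolding U[of \<zeta>] universal_step_def by (auto simp: y k z A(2))
    then show ?thesis unfolding \<Gamma>_def by blast
  qed
  have above: "\<exists>\<zeta>\<in>Z. (\<xi>, \<zeta>) \<in> R" if "\<xi> \<in> Z" for \<xi> using bounded[of "\<lambda>_. \<xi>"] that by auto
  have stepI': "\<exists>\<xi>\<in>Z. - (\<Union>n. A n) \<in> \<Gamma> \<xi>" if A: "\<And>n. \<exists>\<xi>\<in>Z. A n \<in> \<Gamma> \<xi>" for A :: "nat \<Rightarrow> 'a set"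
  proof -
    obtain s where s: "\<And>n. s n \<in> Z" "\<And>n. A n \<in> \<Gamma> (s n)" using A by metis
    then obtain \<zeta> where "\<zeta> \<in> Z" "\<And>n. (s n, \<zeta>) \<in> R" using bounded[of s] by auto
    then show ?thesis using stepI[of A s \<zeta>] s(2) by blast
  qed
  have complI: "\<exists>\<xi>\<in>Z. - A \<in> \<Gamma> \<xi>" if "\<exists>\<xi>\<in>Z. A \<in> \<Gamma> \<xi>" for A
    using stepI'[of "\<lambda>_. A"] that by simp
  have borel_sets: "\<exists>\<xi>\<in>Z. A \<in> \<Gamma> \<xi>" if "A \<in> sets borel" for A
  proof -
    have "A \<in> sigma_sets UNIV \<B>" using that unfolding borel_eq_countable_basis[OF \<B>] by simp
    then show ?thesis
    proof induction
      case (Basic A)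
      then show ?case using basicI range_b Z by (metis ex_in_conv insertI2 rangeE)
    next
      case Empty
      then show ?case using basicI range_b Z by (metis ex_in_conv insertI1 rangeE)
    next
      case (Compl A)
      then show ?case using complI[of A] by (simp add: Compl_eq_Diff_UNIV)
    next
      case (Union A)
      then show ?case using complI[OF stepI'[of A]] by simp
    qed
  qed
  have levels: "\<exists>\<xi>\<in>Z. \<forall>n. \<exists>y. A n = {x. (y, x) \<in> U \<xi>}" if "range A \<subseteq> sets borel" for A :: "nat \<Rightarrow> 'a set"
  proof -
    have "\<forall>n. \<exists>\<xi>\<in>Z. A n \<in> \<Gamma> \<xi>" using borel_sets that by blast
    then obtain s where s: "\<And>n. s n \<in> Z" "\<And>n. A n \<in> \<Gamma> (s n)" by metis
    then obtain \<zeta> where \<zeta>: "\<zeta> \<in> Z" "\<And>n. (s n, \<zeta>) \<in> R" using bounded[of s] by auto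
    obtain \<xi> where \<xi>: "\<xi> \<in> Z" "(\<zeta>, \<xi>) \<in> R" using above \<zeta>(1) by blast
    \<comment> \<open>Complementing twice moves all \<open>A n\<close> from their separate levels to
      the single level \<open>\<xi>\<close>.\<close>
    have "- A n \<in> \<Gamma> \<zeta>" for n using stepI[of "\<lambda>_. A n" "\<lambda>_. s n" \<zeta>] s \<zeta> by simp
    then have "A n \<in> \<Gamma> \<xi>" for n using stepI[of "\<lambda>_. - A n" "\<lambda>_. \<zeta>" \<xi>] \<xi> by simp
    then show ?thesis unfolding \<Gamma>_def using \<xi>(1) by blast
  qed
  show thesis by (rule that[of U]) (fact meas levels)+
qed

text \<open>A Borel function is determined by the sets where it is within \<open>1 / Suc n\<close>
  of the dense point \<open>d k\<close>. These are sections of one \<open>U \<xi>\<close> with codes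
  interleaved in \<open>y\<close>, and the function is the limit of its approximations by the least
  suitable \<open>d k\<close>.\<close>

lemma exists_universal_borel_functions:
  fixes R :: "'i rel" and Z :: "'i set"
  assumes wf: "wf R" and count: "\<And>\<xi>. countable {\<eta>. (\<eta>, \<xi>) \<in> R}" and Z: "Z \<noteq> {}"
    and bounded: "\<And>s :: nat \<Rightarrow> 'i. range s \<subseteq> Z \<Longrightarrow> \<exists>\<zeta>\<in>Z. \<forall>n. (s n, \<zeta>) \<in> R"
  obtains H :: "'i \<Rightarrow> (nat \<Rightarrow> nat) \<Rightarrow> 'a::second_countable_topology \<Rightarrow> 'b::polish_space"
  where "\<And>\<xi>. (\<lambda>(y, x). H \<xi> y x) \<in> borel_measurable (nat_seq \<Otimes>\<^sub>M borel)"
    and "\<And>h. h \<in> borel_measurable borel \<Longrightarrow> \<exists>\<xi>\<in>Z. \<exists>y. H \<xi> y = h"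
proof -
  obtain U :: "'i \<Rightarrow> ((nat \<Rightarrow> nat) \<times> 'a) set"
    where U: "\<And>\<xi>. U \<xi> \<in> sets (nat_seq \<Otimes>\<^sub>M borel)"
    and U_all: "\<And>A :: nat \<Rightarrow> 'a set. range A \<subseteq> sets borel \<Longrightarrow> \<exists>\<xi>\<in>Z. \<forall>n. \<exists>y. A n = {x. (y, x) \<in> U \<xi>}"
    using exists_universal_borel_sets[OF assms] by metis
  obtain d :: "nat \<Rightarrow> 'b" where d: "\<And>U. open U \<Longrightarrow> U \<noteq> {} \<Longrightarrow> \<exists>i. d i \<in> U"
    by (rule exists_dense_sequence) (rule that)
  define f where "f \<xi> n p = d (LEAST k. ((\<lambda>m. fst p (prod_encode (prod_encode (n, k), m))), snd p) \<in> U \<xi>)"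
    for \<xi> n p
  \<comment> \<open>Where the approximations are not Cauchy, the constant \<open>d 0\<close>
    replaces them, so that the limit exists everywhere and is jointly Borel.\<close>
  define f' where "f' \<xi> n p = (if Cauchy (\<lambda>n. f \<xi> n p) then f \<xi> n p else d 0)" for \<xi> n p
  define H where "H \<xi> y x = lim (\<lambda>n. f' \<xi> n (y, x))" for \<xi> y x
  have f_meas[measurable]: "f \<xi> n \<in> borel_measurable (nat_seq \<Otimes>\<^sub>M borel)" for \<xi> n
  proof -
    have "(\<lambda>p :: (nat \<Rightarrow> nat) \<times> 'a. ((\<lambda>m. fst p (prod_encode (prod_encode (n, k), m))), snd p))
      \<in> nat_seq \<Otimes>\<^sub>M borel \<rightarrow>\<^sub>M nat_seq \<Otimes>\<^sub>M borel" for k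
      by (intro measurable_Pair measurable_PiM_single') auto
    from measurable_sets[OF this U]
    have "Measurable.pred (nat_seq \<Otimes>\<^sub>M borel) (\<lambda>p. ((\<lambda>m. fst p (prod_encode (prod_encode (n, k), m))), snd p) \<in> U \<xi>)" for k
      by (simp add: pred_def vimage_def Int_def conj_commute)
    then show ?thesis unfolding f_def by measurable
  qed
  have "Cauchy (\<lambda>n. f' \<xi> n p)" for \<xi> p
    unfolding f'_def by (cases "Cauchy (\<lambda>n. f \<xi> n p)") (auto simp: convergent_Cauchy convergent_const)
  then have lim: "(\<lambda>n. f' \<xi> n (y, x)) \<longlonglongrightarrow> H \<xi> y x" for \<xi> y x
    unfolding H_def by (intro convergent_LIMSEQ_iff[THEN iffD1] Cauchy_convergent)
  show thesis
  proof (rule that[of H])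
    fix \<xi>
    show "(\<lambda>(y, x). H \<xi> y x) \<in> borel_measurable (nat_seq \<Otimes>\<^sub>M borel)"
    proof (rule borel_measurable_LIMSEQ_metric)
      show "f' \<xi> n \<in> borel_measurable (nat_seq \<Otimes>\<^sub>M borel)" for n unfolding f'_def by measurable
      show "(\<lambda>n. f' \<xi> n p) \<longlonglongrightarrow> (case p of (y, x) \<Rightarrow> H \<xi> y x)" for p
        using lim by (cases p) simp
    qed
  next
    fix h :: "'a \<Rightarrow> 'b" assume h[measurable]: "h \<in> borel_measurable borel"
    define A where "A i = (case prod_decode i of (n, k) \<Rightarrow> {x. dist (d k) (h x) < 1 / Suc n})" for i
    have "A i \<in> sets borel" for i
    proof -
      have "{x. dist (d k) (h x) < 1 / Suc n} \<in> sets borel" for n k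
      proof -
        have "{x. dist (d k) (h x) < 1 / Suc n} = h -` ball (d k) (1 / Suc n) \<inter> space borel" by auto
        also have "\<dots> \<in> sets borel" by (rule measurable_sets[OF h]) simp
        finally show ?thesis .
      qed
      then show ?thesis unfolding A_def by (cases "prod_decode i") simp
    qed
    then obtain \<xi> where \<xi>: "\<xi> \<in> Z" "\<forall>i. \<exists>y. A i = {x. (y, x) \<in> U \<xi>}" using U_all[of A] by blast
    then obtain z where z: "\<And>i. A i = {x. (z i, x) \<in> U \<xi>}" by metis
    define y where "y j = (case prod_decode j of (i, m) \<Rightarrow> z i m)" for j
    have y: "(\<lambda>m. y (prod_encode (i, m))) = z i" for i by (auto simp: y_def)
    have mem: "((\<lambda>m. y (prod_encode (prod_encode (n, k), m))), x) \<in> U \<xi> \<longleftrightarrow> dist (d k) (h x) < 1 / Suc n" for n k x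
    proof -
      have "((\<lambda>m. y (prod_encode (prod_encode (n, k), m))), x) \<in> U \<xi> \<longleftrightarrow> x \<in> A (prod_encode (n, k))"
        unfolding y z by simp
      then show ?thesis by (simp add: A_def)
    qed
    have "dist (f \<xi> n (y, x)) (h x) < 1 / Suc n" for n x
    proof -
      have "\<exists>k. d k \<in> ball (h x) (1 / Suc n)" by (rule d) (auto simp: ball_eq_empty)
      then have "\<exists>k. dist (d k) (h x) < 1 / Suc n" by (auto simp: dist_commute)
      then show ?thesis unfolding f_def fst_conv snd_conv mem by (rule LeastI_ex)
    qed
    then have "(\<lambda>n. f \<xi> n (y, x)) \<longlonglongrightarrow> h x" for x
      by (intro metric_tendsto_imp_tendsto[OF LIMSEQ_inverse_real_of_nat] always_eventually)
         (auto simp: inverse_eq_divide intro: less_imp_le)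
    moreover from this have "Cauchy (\<lambda>n. f \<xi> n (y, x))" for x by (rule LIMSEQ_imp_Cauchy)
    ultimately have "(\<lambda>n. f' \<xi> n (y, x)) \<longlonglongrightarrow> h x" for x by (simp add: f'_def)
    then have "H \<xi> y x = h x" for x using lim LIMSEQ_unique by blast
    then show "\<exists>\<xi>\<in>Z. \<exists>y. H \<xi> y = h" using \<xi>(1) by blast
  qed
qed

section \<open>Uniformization of sets with sections of positive measure\<close>

text \<open>
  Borel sets are approximated, uniformly in the first coordinate, from outside by sets with open
  sections and from inside by sets with closed sections that depend on the first coordinate in
  a Borel way; points of compact sections can then be selected by successive approximation.
\<close>

definition section_open :: "('x::topological_space \<times> 'y::topological_space) set \<Rightarrow> bool" where
  "section_open W \<longleftrightarrow> (\<exists>A Q. (\<forall>n::nat. A n \<in> sets borel \<and> open (Q n)) \<and> W = (\<Union>n. A n \<times> Q n))"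

lemma section_open_Times: "A \<in> sets borel \<Longrightarrow> open Q \<Longrightarrow> section_open (A \<times> Q)"
  unfolding section_open_def by (intro exI[of _ "\<lambda>_. A"] exI[of _ "\<lambda>_. Q"]) auto

lemma section_openE:
  assumes "section_open W"
  obtains A Q where "\<And>n. A n \<in> sets borel" "\<And>n. open (Q n)" "W = (\<Union>n::nat. A n \<times> Q n)"
proof -
  obtain A Q where "(\<forall>n::nat. A n \<in> sets borel \<and> open (Q n)) \<and> W = (\<Union>n. A n \<times> Q n)"
    using assms unfolding section_open_def by (elim exE)
  then show thesis by (intro that[of A Q]) auto
qed

lemma section_open_UN:
  assumes "\<And>n::nat. section_open (W n)"
  shows "section_open (\<Union>n. W n)"
proof -
  have "\<forall>n. \<exists>A Q. (\<forall>k::nat. A k \<in> sets borel \<and> open (Q k)) \<and> W n = (\<Union>k. A k \<times> Q k)"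
    using assms unfolding section_open_def by (rule allI)
  then obtain A Q where AQ': "\<forall>n. (\<forall>k::nat. A n k \<in> sets borel \<and> open (Q n k)) \<and> W n = (\<Union>k. A n k \<times> Q n k)"
    unfolding choice_iff by (elim exE)
  then have AQ: "A n k \<in> sets borel" "open (Q n k)" "W n = (\<Union>k. A n k \<times> Q n k)" for n k by auto
  let ?A = "\<lambda>i. case_prod A (prod_decode i)" and ?Q = "\<lambda>i. case_prod Q (prod_decode i)"
  have "(\<Union>n. W n) = (\<Union>i. ?A i \<times> ?Q i)" (is "?l = ?r")
  proof (intro set_eqI iffI)
    fix z assume "z \<in> ?l"
    then obtain n where "z \<in> W n" by (rule UN_E)
    then have "z \<in> (\<Union>k. A n k \<times> Q n k)" using AQ(3)[of n] by simp
    then obtain k where "z \<in> A n k \<times> Q n k" by (rule UN_E)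
    then have "z \<in> ?A (prod_encode (n, k)) \<times> ?Q (prod_encode (n, k))" by simp
    then show "z \<in> ?r" by (rule UN_I[OF UNIV_I])
  next
    fix z assume "z \<in> ?r"
    then obtain i where i: "z \<in> ?A i \<times> ?Q i" by (rule UN_E)
    obtain n k where nk: "prod_decode i = (n, k)" by fastforce
    have "z \<in> W n" unfolding AQ(3)[of n] by (rule UN_I[of k]) (use i nk in auto)
    then show "z \<in> ?l" by blast
  qed
  moreover have "?A i \<in> sets borel" "open (?Q i)" for i using AQ by (simp_all split: prod.split)
  ultimately show ?thesis unfolding section_open_def by (intro exI[of _ ?A] exI[of _ ?Q]) simp
qed

lemma section_open_Int:
  assumes "section_open V" "section_open W"
  shows "section_open (V \<inter> W)"
proof -
  obtain A Q where AQ: "\<And>k. A k \<in> sets borel" "\<And>k. open (Q k)" "V = (\<Union>k::nat. A k \<times> Q k)"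
    using assms(1) by (rule section_openE) (rule that)
  obtain A' Q' where AQ': "\<And>k. A' k \<in> sets borel" "\<And>k. open (Q' k)" "W = (\<Union>k::nat. A' k \<times> Q' k)"
    using assms(2) by (rule section_openE) (rule that)
  have "V \<inter> W = (\<Union>n. \<Union>k. (A n \<inter> A' k) \<times> (Q n \<inter> Q' k))" unfolding AQ(3) AQ'(3) by auto
  then show ?thesis
    using AQ AQ' by (simp only:) (intro section_open_UN section_open_Times sets.Int open_Int)
qed

lemma section_open_INT_finite:
  assumes "\<And>i. i \<le> n \<Longrightarrow> section_open (W i)"
  shows "section_open (\<Inter>i\<le>(n::nat). W i)"
  using assms
proof (induction n)
  case (Suc n)
  then show ?case by (simp add: atMost_Suc section_open_Int)
qed simp

lemma section_open_measurable:
  assumes "section_open W" shows "W \<in> sets (borel \<Otimes>\<^sub>M borel)"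
proof -
  obtain A Q where AQ: "\<And>n. A n \<in> sets borel" "\<And>n. open (Q n)" "W = (\<Union>n::nat. A n \<times> Q n)"
    using assms by (rule section_openE) (rule that)
  then show ?thesis by auto
qed

definition section_approximable ::
    "'y::topological_space measure \<Rightarrow> ('x::topological_space \<times> 'y) set \<Rightarrow> bool" where
  "section_approximable \<mu> W \<longleftrightarrow> (\<forall>\<epsilon>>0. \<exists>V F. section_open V \<and> section_open (- F) \<and> F \<subseteq> W \<and> W \<subseteq> V \<and>
     (\<forall>x. measure \<mu> {y. (x, y) \<in> V - F} < \<epsilon>))"

lemma section_approximable_Compl:
  assumes "section_approximable \<mu> W" shows "section_approximable \<mu> (- W)"
  unfolding section_approximable_def
proof (intro allI impI)
  fix \<epsilon> :: real assume "\<epsilon> > 0"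
  then obtain V F where VF: "section_open V" "section_open (- F)" "F \<subseteq> W" "W \<subseteq> V"
    "\<forall>x. measure \<mu> {y. (x, y) \<in> V - F} < \<epsilon>"
    using assms unfolding section_approximable_def by blast
  have "- F - (- V) = V - F" by auto
  then have "section_open (- F) \<and> section_open (- (- V)) \<and> - V \<subseteq> - W \<and> - W \<subseteq> - F \<and>
    (\<forall>x. measure \<mu> {y. (x, y) \<in> - F - (- V)} < \<epsilon>)" using VF by auto
  then show "\<exists>V F. section_open V \<and> section_open (- F) \<and> F \<subseteq> - W \<and> - W \<subseteq> V \<and>
    (\<forall>x. measure \<mu> {y. (x, y) \<in> V - F} < \<epsilon>)" by blast
qed

text \<open>The outer sets may be united, but an infinite union of closed sections can fail to be
  closed. It is cut off after finitely many terms, their number \<open>N x\<close> depending on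
  \<open>x\<close> in a Borel way.\<close>

lemma section_approximable_UN:
  fixes \<mu> :: "'y::topological_space measure" and W :: "nat \<Rightarrow> ('x::topological_space \<times> 'y) set"
  assumes \<mu>: "prob_space \<mu>" "sets \<mu> = sets borel" and W: "\<And>n. section_approximable \<mu> (W n)"
  shows "section_approximable \<mu> (\<Union>n. W n)"
  unfolding section_approximable_def
proof (intro allI impI)
  interpret prob_space \<mu> by fact
  note [measurable_cong] = \<mu>(2)
  fix \<epsilon> :: real assume "\<epsilon> > 0"
  \<comment> \<open>These tolerances add up to \<open>\<epsilon> / 2\<close>, which leaves room for
    the truncation.\<close>
  have "\<forall>n. \<exists>V F. section_open V \<and> section_open (- F) \<and> F \<subseteq> W n \<and> W n \<subseteq> V \<and>
     (\<forall>x. measure \<mu> {y. (x, y) \<in> V - F} < \<epsilon> / 2 * (1/2) ^ Suc n)"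
  proof
    fix n
    have "\<epsilon> / 2 * (1/2) ^ Suc n > 0" using \<open>\<epsilon> > 0\<close> by simp
    then show "\<exists>V F. section_open V \<and> section_open (- F) \<and> F \<subseteq> W n \<and> W n \<subseteq> V \<and>
       (\<forall>x. measure \<mu> {y. (x, y) \<in> V - F} < \<epsilon> / 2 * (1/2) ^ Suc n)"
      using W[of n] unfolding section_approximable_def by blast
  qed
  then obtain V F where V: "\<And>n. section_open (V n)" and F: "\<And>n. section_open (- F n)"
    and FW: "\<And>n. F n \<subseteq> W n" and WV: "\<And>n. W n \<subseteq> V n"
    and small: "\<And>n x. measure \<mu> {y. (x, y) \<in> V n - F n} < \<epsilon> / 2 * (1/2) ^ Suc n" by metis
  have V_meas[measurable]: "V n \<in> sets (borel \<Otimes>\<^sub>M borel)" for n by (rule section_open_measurable[OF V])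
  have F_meas[measurable]: "F n \<in> sets (borel \<Otimes>\<^sub>M borel)" for n
  proof -
    have "space (borel \<Otimes>\<^sub>M borel) - (- F n) \<in> sets (borel \<Otimes>\<^sub>M borel)"
      by (intro sets.compl_sets section_open_measurable F)
    then show ?thesis by (simp add: space_pair_measure Diff_eq)
  qed
  define D where "D N = (\<Union>n. V n) - (\<Union>i\<le>N. F i)" for N
  have D_meas[measurable]: "D N \<in> sets (borel \<Otimes>\<^sub>M borel)" for N unfolding D_def by measurable
  have section_meas: "{y. (x, y) \<in> A} \<in> sets \<mu>" if "A \<in> sets (borel \<Otimes>\<^sub>M borel)" for x and A :: "('x \<times> 'y) set"
    using sets_Pair1[OF that, of x] by (simp add: vimage_def \<mu>)
  have ex: "\<exists>N. measure \<mu> {y. (x, y) \<in> D N} < \<epsilon>" for x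
  proof -
    let ?B = "\<lambda>n. {y. (x, y) \<in> V n - F n}"
    have B_meas: "?B n \<in> sets \<mu>" for n by (rule section_meas) measurable
    have geo: "(\<lambda>n. \<epsilon> / 2 * (1/2) ^ Suc n) sums (\<epsilon> / 2 * 1)"
      by (intro sums_mult power_half_series)
    have sumB: "summable (\<lambda>n. measure \<mu> (?B n))"
      by (rule summable_comparison_test'[OF sums_summable[OF geo], of 0])
         (use small less_imp_le in auto)
    have "measure \<mu> (\<Union>n. ?B n) \<le> (\<Sum>n. measure \<mu> (?B n))"
      using B_meas by (intro finite_measure_subadditive_countably sumB) auto
    also have "\<dots> \<le> (\<Sum>n. \<epsilon> / 2 * (1/2) ^ Suc n)"
      by (intro suminf_le sumB sums_summable[OF geo] less_imp_le small)
    also have "\<dots> < \<epsilon>" using sums_unique[OF geo] \<open>\<epsilon> > 0\<close> by simp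
    finally have lt: "measure \<mu> (\<Union>n. ?B n) < \<epsilon>" .
    have lim: "(\<lambda>N. measure \<mu> {y. (x, y) \<in> D N}) \<longlonglongrightarrow> measure \<mu> (\<Inter>N. {y. (x, y) \<in> D N})"
      by (intro finite_Lim_measure_decseq) (auto simp: decseq_def D_def intro!: section_meas intro: order_trans)
    have le: "measure \<mu> (\<Inter>N. {y. (x, y) \<in> D N}) \<le> measure \<mu> (\<Union>n. ?B n)"
    proof (rule finite_measure_mono)
      show "(\<Inter>N. {y. (x, y) \<in> D N}) \<subseteq> (\<Union>n. ?B n)"
      proof
        fix y assume y: "y \<in> (\<Inter>N. {y. (x, y) \<in> D N})"
        then obtain n where "(x, y) \<in> V n" by (auto simp: D_def)
        moreover have "(x, y) \<in> D n" using y by blast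
        then have "(x, y) \<notin> F n" by (auto simp: D_def)
        ultimately show "y \<in> (\<Union>n. ?B n)" by blast
      qed
    qed (use B_meas in auto)
    from le lt have "measure \<mu> (\<Inter>N. {y. (x, y) \<in> D N}) < \<epsilon>" by linarith
    with lim have "eventually (\<lambda>N. measure \<mu> {y. (x, y) \<in> D N} < \<epsilon>) sequentially"
      by (rule order_tendstoD(2))
    then show ?thesis by (auto simp: eventually_sequentially)
  qed
  define N where "N x = (LEAST N. measure \<mu> {y. (x, y) \<in> D N} < \<epsilon>)" for x
  have N: "measure \<mu> {y. (x, y) \<in> D (N x)} < \<epsilon>" for x unfolding N_def using ex by (rule LeastI_ex)
  have N_meas[measurable]: "N \<in> borel \<rightarrow>\<^sub>M count_space UNIV"
  proof -
    have "(\<lambda>x. emeasure \<mu> (Pair x -` D n)) \<in> borel_measurable borel" for n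
      by (rule measurable_emeasure_Pair) (simp add: D_meas sets_pair_measure_cong[OF refl \<mu>(2)])
    then have [measurable]: "(\<lambda>x. measure \<mu> {y. (x, y) \<in> D n}) \<in> borel_measurable borel" for n
      unfolding measure_def vimage_def by measurable
    show ?thesis unfolding N_def by measurable
  qed
  define G where "G = {(x, y). \<exists>i\<le>N x. (x, y) \<in> F i}"
  have "- G = (\<Union>n. ((N -` {n}) \<times> UNIV) \<inter> (\<Inter>i\<le>n. - F i))" unfolding G_def by auto
  moreover have "section_open (\<Union>n. ((N -` {n}) \<times> UNIV) \<inter> (\<Inter>i\<le>n. - F i))"
    using measurable_sets[OF N_meas, of "{_}"]
    by (intro section_open_UN section_open_Int section_open_INT_finite F section_open_Times) auto
  ultimately have "section_open (- G)" by simp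
  moreover have "section_open (\<Union>n. V n)" by (intro section_open_UN V)
  moreover have "G \<subseteq> (\<Union>n. W n)" using FW by (force simp: G_def)
  moreover have "(\<Union>n. W n) \<subseteq> (\<Union>n. V n)" by (intro UN_mono subset_refl WV)
  moreover have "{y. (x, y) \<in> (\<Union>n. V n) - G} = {y. (x, y) \<in> D (N x)}" for x
    by (auto simp: D_def G_def)
  ultimately show "\<exists>V F. section_open V \<and> section_open (- F) \<and> F \<subseteq> (\<Union>n. W n) \<and> (\<Union>n. W n) \<subseteq> V \<and>
     (\<forall>x. measure \<mu> {y. (x, y) \<in> V - F} < \<epsilon>)"
    using N by (intro exI[of _ "\<Union>n. V n"] exI[of _ G]) simp
qed

text \<open>The approximable sets form a \<sigma>-algebra, so it is enough that both projections are
  measurable; for the second one this is inner regularity of \<open>\<mu>\<close>.\<close>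

lemma section_approximable_borel:
  fixes \<mu> :: "'y::polish_space measure" and W :: "('x::topological_space \<times> 'y) set"
  assumes \<mu>: "prob_space \<mu>" "sets \<mu> = sets borel" and W: "W \<in> sets (borel \<Otimes>\<^sub>M borel)"
  shows "section_approximable \<mu> W"
proof -
  interpret prob_space \<mu> by fact
  define \<Sigma> where "\<Sigma> = sigma UNIV {W :: ('x \<times> 'y) set. section_approximable \<mu> W}"
  have empty: "section_approximable \<mu> ({} :: ('x \<times> 'y) set)"
    unfolding section_approximable_def
    using section_open_Times[of "{}" "{}"] section_open_Times[of UNIV UNIV]
    by (auto intro!: exI[of _ "{}"])
  have \<Sigma>: "section_approximable \<mu> A" if "A \<in> sets \<Sigma>" for A
  proof -
    have "A \<in> sigma_sets UNIV {W :: ('x \<times> 'y) set. section_approximable \<mu> W}" using that by (simp add: \<Sigma>_def)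
    then show ?thesis
    proof induction
      case (Compl A)
      then show ?case using section_approximable_Compl[of \<mu> A] by (simp add: Compl_eq_Diff_UNIV)
    next
      case (Union A)
      then show ?case by (intro section_approximable_UN \<mu>)
    qed (auto simp: empty)
  qed
  have fst: "fst \<in> \<Sigma> \<rightarrow>\<^sub>M (borel :: 'x measure)"
  proof (rule measurableI)
    fix A :: "'x set" assume A: "A \<in> sets borel"
    have "- (A \<times> (UNIV :: 'y set)) = (- A) \<times> UNIV" by auto
    then have "section_approximable \<mu> (A \<times> (UNIV :: 'y set))"
      unfolding section_approximable_def using A section_open_Times[of A UNIV] section_open_Times[of "- A" UNIV]
      by (auto intro!: exI[of _ "A \<times> UNIV"])
    moreover have "fst -` A \<inter> space \<Sigma> = A \<times> UNIV" by (auto simp: \<Sigma>_def)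
    ultimately show "fst -` A \<inter> space \<Sigma> \<in> sets \<Sigma>" by (auto simp: \<Sigma>_def)
  qed auto
  have snd: "snd \<in> \<Sigma> \<rightarrow>\<^sub>M (borel :: 'y measure)"
  proof (rule borel_measurableI)
    fix Q :: "'y set" assume Q: "open Q"
    have "section_approximable \<mu> ((UNIV :: 'x set) \<times> Q)"
      unfolding section_approximable_def
    proof (intro allI impI)
      fix \<epsilon> :: real assume "\<epsilon> > 0"
      have reg: "emeasure \<mu> Q = (SUP K\<in>{K. K \<subseteq> Q \<and> compact K}. emeasure \<mu> K)"
        by (rule inner_regular) (use Q \<mu> in auto)
      obtain K where K: "K \<subseteq> Q" "compact K" "measure \<mu> Q - \<epsilon> < measure \<mu> K"
      proof (cases "measure \<mu> Q < \<epsilon>")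
        case True
        then show thesis using that[of "{}"] by simp
      next
        case False
        have "ennreal (measure \<mu> Q - \<epsilon>) < emeasure \<mu> Q"
          unfolding emeasure_eq_measure using False \<open>\<epsilon> > 0\<close> by (intro ennreal_lessI) auto
        then obtain K where "K \<subseteq> Q" "compact K" "ennreal (measure \<mu> Q - \<epsilon>) < emeasure \<mu> K"
          unfolding reg less_SUP_iff by blast
        then show thesis using that[of K] False by (simp add: emeasure_eq_measure ennreal_less_iff)
      qed
      have meas: "Q \<in> sets \<mu>" "K \<in> sets \<mu>" using Q K(2) \<mu>(2) by (auto intro: borel_compact)
      have "measure \<mu> (Q - K) < \<epsilon>" using finite_measure_Diff[OF meas K(1)] K(3) by simp
      moreover have "- ((UNIV :: 'x set) \<times> K) = UNIV \<times> (- K)" by auto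
      moreover have "open (- K)" using K(2) by (simp add: compact_imp_closed open_Compl)
      ultimately show "\<exists>V F. section_open V \<and> section_open (- F) \<and> F \<subseteq> (UNIV :: 'x set) \<times> Q \<and> UNIV \<times> Q \<subseteq> V \<and>
        (\<forall>x. measure \<mu> {y. (x, y) \<in> V - F} < \<epsilon>)"
        using K(1) Q section_open_Times[of UNIV]
        by (intro exI[of _ "UNIV \<times> Q"] exI[of _ "UNIV \<times> K"]) (auto simp: set_diff_eq)
    qed
    moreover have "snd -` Q \<inter> space \<Sigma> = UNIV \<times> Q" by (auto simp: \<Sigma>_def)
    ultimately show "snd -` Q \<inter> space \<Sigma> \<in> sets \<Sigma>" by (auto simp: \<Sigma>_def)
  qed
  have "(\<lambda>p. (fst p, snd p)) \<in> \<Sigma> \<rightarrow>\<^sub>M borel \<Otimes>\<^sub>M borel" by (rule measurable_Pair[OF fst snd])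
  from measurable_sets[OF this W] have "W \<in> sets \<Sigma>" by (simp add: \<Sigma>_def)
  then show ?thesis by (rule \<Sigma>)
qed

text \<open>An inner approximation \<open>F\<close> with error below \<open>\<delta>\<close> still
  has nonempty sections, and these are compact. A point of each is found through shrinking closed
  balls about dense points, always the first one that keeps meeting the section.\<close>

lemma uniformization_compact_sections:
  fixes \<mu> :: "'y::polish_space measure" and W :: "('x::topological_space \<times> 'y) set"
  assumes \<mu>: "prob_space \<mu>" "sets \<mu> = sets borel" and W: "W \<in> sets (borel \<Otimes>\<^sub>M borel)"
    and L: "compact L" "W \<subseteq> UNIV \<times> L"
    and \<delta>: "\<delta> > 0" "\<And>x. measure \<mu> {y. (x, y) \<in> W} \<ge> \<delta>"
  shows "\<exists>h \<in> borel_measurable borel. \<forall>x. (x, h x) \<in> W"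
proof -
  interpret prob_space \<mu> by fact
  obtain V F where VF: "section_open V" "section_open (- F)" "F \<subseteq> W" "W \<subseteq> V"
    "\<And>x. measure \<mu> {y. (x, y) \<in> V - F} < \<delta>"
    using section_approximable_borel[OF \<mu> W] \<delta>(1) unfolding section_approximable_def by blast
  have ne: "\<exists>y. (x, y) \<in> F" for x
  proof (rule ccontr)
    assume "\<not> ?thesis"
    then have "{y. (x, y) \<in> V - F} = {y. (x, y) \<in> V}" by auto
    moreover have "measure \<mu> {y. (x, y) \<in> W} \<le> measure \<mu> {y. (x, y) \<in> V}"
      using VF(4) sets_Pair1[OF section_open_measurable[OF VF(1)], of x]
      by (intro finite_measure_mono) (auto simp: vimage_def \<mu>)
    ultimately show False using VF(5)[of x] \<delta>(2)[of x] by simp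
  qed
  obtain A Q where AQ: "\<And>n. A n \<in> sets borel" "\<And>n. open (Q n)" "- F = (\<Union>n::nat. A n \<times> Q n)"
    using VF(2) by (rule section_openE) (rule that)
  have closed: "closed {y. (x, y) \<in> F}" for x
  proof -
    have "- {y. (x, y) \<in> F} = {y. (x, y) \<in> - F}" by auto
    also have "\<dots> = (\<Union>n\<in>{n. x \<in> A n}. Q n)" unfolding AQ(3) by auto
    finally show ?thesis using AQ(2) by (metis closed_def open_UN)
  qed
  \<comment> \<open>By compactness, a section avoids \<open>C\<close> iff finitely many
    \<open>Q n\<close> with \<open>x \<in> A n\<close> cover \<open>C\<close>; there are countably
    many finite index sets.\<close>
  have hit: "{x. \<exists>y\<in>C. (x, y) \<in> F} \<in> sets borel" if C: "compact C" for C
  proof -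
    have eq: "- {x. \<exists>y\<in>C. (x, y) \<in> F} = (\<Union>I\<in>{I. finite I \<and> C \<subseteq> (\<Union>n\<in>I. Q n)}. \<Inter>n\<in>I. A n)" (is "?l = ?r")
    proof (intro set_eqI iffI)
      fix x assume "x \<in> ?l"
      then have "C \<subseteq> {y. (x, y) \<in> - F}" by auto
      then have "C \<subseteq> (\<Union>n\<in>{n. x \<in> A n}. Q n)" unfolding AQ(3) by auto
      then obtain I where "I \<subseteq> {n. x \<in> A n}" "finite I" "C \<subseteq> (\<Union>n\<in>I. Q n)"
        using compactE_image[OF C, of "{n. x \<in> A n}" Q] AQ(2) by metis
      then show "x \<in> ?r" by auto
    next
      fix x assume "x \<in> ?r"
      then obtain I where "C \<subseteq> (\<Union>n\<in>I. Q n)" "\<forall>n\<in>I. x \<in> A n" by auto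
      then have "C \<subseteq> {y. (x, y) \<in> - F}" unfolding AQ(3) by blast
      then show "x \<in> ?l" by auto
    qed
    have "countable {I :: nat set. finite I \<and> C \<subseteq> (\<Union>n\<in>I. Q n)}"
      by (rule countable_subset[OF _ countable_Collect_finite]) auto
    moreover have "(\<Inter>n\<in>I. A n) \<in> sets borel" if "finite I" for I
      using AQ(1) that by (cases "I = {}") auto
    ultimately have "?r \<in> sets borel" by (intro sets.countable_UN'') auto
    then have "- ?l \<in> sets borel" unfolding eq by (rule borel_comp)
    then show ?thesis by simp
  qed
  obtain d :: "nat \<Rightarrow> 'y" where d: "\<And>U. open U \<Longrightarrow> U \<noteq> {} \<Longrightarrow> \<exists>i. d i \<in> U"
    by (rule exists_dense_sequence) (rule that)
  define B where "B s = L \<inter> (\<Inter>j<length s. cball (d (s ! j)) ((1/2) ^ Suc j))" for s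
  have B_compact: "compact (B s)" for s
    unfolding B_def by (intro compact_Int_closed L closed_INT ballI closed_cball)
  have B_snoc: "B (s @ [i]) = B s \<inter> cball (d i) ((1/2) ^ Suc (length s))" for s i
    by (auto simp: B_def nth_append lessThan_Suc)
  have B_D: "y \<in> cball (d (s ! j)) ((1/2) ^ Suc j)" if "y \<in> B s" "j < length s" for y s j
    using that by (auto simp: B_def)
  define p where "p x = rec_nat [] (\<lambda>_ s. s @ [LEAST i. \<exists>y\<in>B (s @ [i]). (x, y) \<in> F])" for x
  have p_0: "p x 0 = []" and p_Suc: "p x (Suc n) = p x n @ [LEAST i. \<exists>y\<in>B (p x n @ [i]). (x, y) \<in> F]" for x n
    by (simp_all add: p_def)
  have len: "length (p x n) = n" for x n by (induction n) (simp_all add: p_0 p_Suc)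
  have p_meets: "\<exists>y\<in>B (p x n). (x, y) \<in> F" for x n
  proof (induction n)
    case 0
    then show ?case using ne[of x] VF(3) L(2) by (auto simp: p_0 B_def)
  next
    case (Suc n)
    then obtain y where y: "y \<in> B (p x n)" "(x, y) \<in> F" by blast
    have "ball y ((1/2) ^ Suc n) \<noteq> {}" by (simp add: ball_eq_empty not_le)
    then obtain i where "d i \<in> ball y ((1/2) ^ Suc n)" using d[OF open_ball] by blast
    then have "y \<in> B (p x n @ [i])" using y by (simp add: B_snoc len dist_commute)
    then have "\<exists>i. \<exists>y\<in>B (p x n @ [i]). (x, y) \<in> F" using y by blast
    then show ?case unfolding p_Suc by (rule LeastI_ex)
  qed
  have p_meas: "(\<lambda>x. p x n) \<in> borel \<rightarrow>\<^sub>M count_space UNIV" for n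
  proof (induction n)
    case (Suc n)
    have "(\<lambda>x. s @ [LEAST i. \<exists>y\<in>B (s @ [i]). (x, y) \<in> F]) \<in> borel \<rightarrow>\<^sub>M count_space UNIV" for s
    proof -
      have [measurable]: "Measurable.pred borel (\<lambda>x. \<exists>y\<in>B (s @ [i]). (x, y) \<in> F)" for i
        using hit[OF B_compact, of "s @ [i]"] by (simp add: pred_def)
      show ?thesis by measurable
    qed
    from measurable_compose_countable[OF this Suc] show ?case by (simp add: p_Suc)
  qed (simp add: p_0)
  define a where "a n x = d (p x (Suc n) ! n)" for n x
  \<comment> \<open>The centres \<open>a n\<close> are measurable in \<open>x\<close>; the points
    \<open>z x n\<close>, chosen freely in the section nearby, bound the steps between centres and
    put their limit into the closed section.\<close>
  define z where "z x n = (SOME y. y \<in> B (p x (Suc n)) \<and> (x, y) \<in> F)" for x n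
  have z: "z x n \<in> B (p x (Suc n))" "(x, z x n) \<in> F" for x n
    using someI_ex[of "\<lambda>y. y \<in> B (p x (Suc n)) \<and> (x, y) \<in> F"] p_meets[of x "Suc n"]
    unfolding z_def by blast+
  have za: "dist (a n x) (z x n) \<le> (1/2) ^ Suc n" for x n
  proof -
    have "z x n \<in> cball (d (p x (Suc n) ! n)) ((1/2) ^ Suc n)"
      by (rule B_D[OF z(1)]) (simp add: len)
    then show ?thesis by (simp add: a_def)
  qed
  have za': "dist (a n x) (z x (Suc n)) \<le> (1/2) ^ Suc n" for x n
  proof -
    have "z x (Suc n) \<in> cball (d (p x (Suc (Suc n)) ! n)) ((1/2) ^ Suc n)"
      by (rule B_D[OF z(1)]) (simp add: len)
    moreover have "p x (Suc (Suc n)) ! n = p x (Suc n) ! n"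
      by (subst p_Suc) (simp add: nth_append len)
    ultimately show ?thesis by (simp add: a_def)
  qed
  have "Cauchy (\<lambda>n. a n x)" for x
  proof (rule Cauchy_if_dist_Suc_le_half_power)
    fix n
    have "dist (a n x) (a (Suc n) x) \<le> dist (a n x) (z x (Suc n)) + dist (a (Suc n) x) (z x (Suc n))"
      by (rule dist_triangle2)
    also have "\<dots> \<le> (1/2) ^ Suc n + (1/2) ^ Suc (Suc n)" by (intro add_mono za za')
    also have "\<dots> \<le> (1/2) ^ n" by simp
    finally show "dist (a n x) (a (Suc n) x) \<le> (1/2) ^ n" .
  qed
  then have "\<forall>x. \<exists>l. (\<lambda>n. a n x) \<longlonglongrightarrow> l" using Cauchy_convergent unfolding convergent_def by blast
  then obtain h where h: "\<And>x. (\<lambda>n. a n x) \<longlonglongrightarrow> h x" by metis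
  have "h \<in> borel_measurable borel"
  proof (rule borel_measurable_LIMSEQ_metric)
    show "a n \<in> borel_measurable borel" for n
      unfolding a_def by (rule measurable_compose[OF p_meas]) simp
  qed (rule h)
  moreover have "(x, h x) \<in> F" for x
  proof -
    have "(\<lambda>n. dist (a n x) (z x n)) \<longlonglongrightarrow> 0"
    proof (rule tendsto_sandwich[of "\<lambda>_. 0" _ _ "\<lambda>n. (1/2) ^ Suc n"])
      show "(\<lambda>n. (1/2::real) ^ Suc n) \<longlonglongrightarrow> 0" using LIMSEQ_realpow_zero[of "1/2"] LIMSEQ_Suc by auto
    qed (use za in \<open>auto intro!: always_eventually tendsto_const\<close>)
    from tendsto_add[OF this h[of x, unfolded tendsto_dist_iff[of "\<lambda>n. a n x"]]]
    have "(\<lambda>n. dist (a n x) (z x n) + dist (a n x) (h x)) \<longlonglongrightarrow> 0" by simp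
    then have "(\<lambda>n. dist (z x n) (h x)) \<longlonglongrightarrow> 0"
      by (rule tendsto_sandwich[of "\<lambda>_. 0", rotated 3])
        (auto intro!: always_eventually tendsto_const dist_triangle3)
    then have "(\<lambda>n. z x n) \<longlonglongrightarrow> h x" by (subst tendsto_dist_iff)
    then have "h x \<in> {y. (x, y) \<in> F}"
      by (rule closed_sequentially[OF closed, rotated]) (use z(2) in auto)
    then show ?thesis by simp
  qed
  ultimately show ?thesis using VF(3) by blast
qed

section \<open>The family of Haar null sets\<close>

text \<open>By tightness some compact \<open>L\<close> has positive measure, and for each
  \<open>t\<close> almost all \<open>p\<close> in \<open>L\<close> satisfy
  \<open>p + t \<notin> B\<close>. Uniformization selects such a \<open>p\<close> measurably in
  \<open>t\<close>.\<close>

lemma haar_null_witness_selector: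
  fixes B :: "'a::{polish_space, topological_ab_group_add} set"
  assumes B: "B \<in> sets borel" and \<mu>: "prob_space \<mu>" "sets \<mu> = sets borel"
    and null: "\<And>g. emeasure \<mu> {x. x - g \<in> B} = 0"
  obtains L h where "compact L" "h \<in> borel_measurable borel" "\<And>t. h t \<in> L" "\<And>t. h t + t \<notin> B"
proof -
  interpret prob_space \<mu> by fact
  have sp: "space \<mu> = UNIV" using sets_eq_imp_space_eq[OF \<mu>(2)] by simp
  have "emeasure \<mu> UNIV = (SUP K\<in>{K. K \<subseteq> UNIV \<and> compact K}. emeasure \<mu> K)"
    by (rule inner_regular) (use \<mu> in auto)
  then have "0 < (SUP K\<in>{K. K \<subseteq> UNIV \<and> compact K}. emeasure \<mu> K)"
    using emeasure_space_1 sp by simp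
  then obtain L where L: "compact L" "emeasure \<mu> L > 0" unfolding less_SUP_iff by blast
  have L_meas: "L \<in> sets borel" using L(1) by (rule borel_compact)
  define W where "W = {z. snd z \<in> L \<and> snd z + fst z \<notin> B}"
  have "W \<in> sets (borel \<Otimes>\<^sub>M borel)"
  proof -
    have [measurable]: "L \<in> sets borel" "B \<in> sets borel" by fact+
    have "Measurable.pred (borel \<Otimes>\<^sub>M borel) (\<lambda>z. snd z \<in> L \<and> snd z + fst z \<notin> B)" by measurable
    then show ?thesis by (simp add: W_def pred_def space_pair_measure)
  qed
  moreover have "measure \<mu> {p. (t, p) \<in> W} \<ge> measure \<mu> L" for t
  proof -
    have "{p. (t, p) \<in> W} = L - {x. x - (- t) \<in> B}" by (auto simp: W_def)
    moreover have "{x. x - (- t) \<in> B} \<in> null_sets \<mu>"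
      using null[of "- t"] borel_translate[OF B, of "- t"] by (simp add: null_sets_def \<mu>)
    ultimately show ?thesis using L_meas by (simp add: measure_Diff_null_set \<mu>)
  qed
  moreover have "W \<subseteq> UNIV \<times> L" by (auto simp: W_def)
  moreover have "measure \<mu> L > 0" using L(2) by (simp add: emeasure_eq_measure)
  ultimately obtain h where h: "h \<in> borel_measurable borel" "\<And>t. (t, h t) \<in> W"
    using uniformization_compact_sections[OF \<mu> _ L(1), of W "measure \<mu> L"] by metis
  then show thesis by (intro that[of L h] L(1)) (auto simp: W_def)
qed

text \<open>Sends a real to its cut in the rationals; it transports Lebesgue measure on the unit
  interval to an atomless measure on the Cantor set.\<close>

lemma exists_injective_real_to_bool_seq:
  obtains e :: "real \<Rightarrow> nat \<Rightarrow> bool" where "inj e" "e \<in> borel \<rightarrow>\<^sub>M bool_seq"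
proof -
  define q where "q = from_nat_into (\<rat> :: real set)"
  have q: "range q = \<rat>" unfolding q_def by (rule range_from_nat_into) (auto simp: countable_rat)
  define e where "e u n = (u < q n)" for u n
  have ne: "e u \<noteq> e v" if "u < v" for u v
  proof -
    obtain r where "r \<in> \<rat>" "u < r" "r < v" using Rats_dense_in_real[of u v] \<open>u < v\<close> by blast
    then obtain n where "u < q n" "q n < v" using q by (metis rangeE)
    then have "e u n \<noteq> e v n" by (simp add: e_def)
    then show ?thesis by auto
  qed
  have "inj e" by (rule injI) (metis ne linorder_neqE_linordered_idom)
  moreover have "e \<in> borel \<rightarrow>\<^sub>M bool_seq"
    by (rule measurable_PiM_single') (auto simp: e_def)
  ultimately show thesis by (rule that)
qed

section \<open>The sets \<open>E \<xi>\<close>: each is Haar null, their union is not\<close>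

context digit_scheme
begin

text \<open>By \<open>decode_eq\<close>, subtracting a point of the Cantor set from a point of this
  set keeps the decoded index. So all its points of the form \<open>cantor e - g\<close> have index
  \<open>decode (- g)\<close> and coincide, and an atomless measure on the Cantor set is a witness.
  Describing the set through \<open>decode\<close>, not as an image, makes it Borel.\<close>

lemma haar_null_decoded_points:
  assumes P: "P \<in> borel_measurable nat_seq"
  shows "haar_null {x. (\<forall>n. P (decode x) \<in> covered n (decode x n)) \<and> x = P (decode x) + shift (decode x)}"
    (is "haar_null ?E")
proof -
  have dec[measurable]: "decode \<in> borel \<rightarrow>\<^sub>M nat_seq"
    by (rule measurable_PiM_single') (auto simp: decode_measurable)
  note [measurable] = P
  have Pd[measurable]: "(\<lambda>x. P (decode x)) \<in> borel_measurable borel" by measurable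
  have "Measurable.pred borel (\<lambda>x. P (decode x) \<in> covered n (decode x n))" for n
  proof (rule measurable_compose_countable[OF _ decode_measurable])
    show "Measurable.pred borel (\<lambda>x. P (decode x) \<in> covered n j)" for j
    proof -
      have [measurable]: "covered n j \<in> sets borel" using open_covered by (rule borel_open)
      show ?thesis by measurable
    qed
  qed
  moreover have "Measurable.pred borel (\<lambda>x. x = P (decode x) + shift (decode x))" by measurable
  ultimately have "Measurable.pred borel (\<lambda>x. (\<forall>n. P (decode x) \<in> covered n (decode x n)) \<and> x = P (decode x) + shift (decode x))"
    by (intro pred_intros_logic(3) pred_intros_countable(1))
  then have E: "?E \<in> sets borel" by (simp add: pred_def)
  obtain e :: "real \<Rightarrow> nat \<Rightarrow> bool" where e: "inj e" "e \<in> borel \<rightarrow>\<^sub>M bool_seq"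
    by (rule exists_injective_real_to_bool_seq)
  define c' where "c' u = cantor (e u)" for u
  define \<nu> where "\<nu> = uniform_measure lborel {0..1::real}"
  define \<mu> where "\<mu> = distr \<nu> borel c'"
  have sets_\<nu>: "sets \<nu> = sets borel" and space_\<nu>: "space \<nu> = UNIV" by (simp_all add: \<nu>_def)
  have prob: "prob_space \<nu>" unfolding \<nu>_def by (rule prob_space_uniform_measure) auto
  have c': "c' \<in> borel_measurable \<nu>"
    unfolding c'_def measurable_cong_sets[OF sets_\<nu> refl] by (rule measurable_compose[OF e(2) cantor_measurable])
  have "emeasure \<mu> {x. x - g \<in> ?E} = 0" for g
  proof -
    define k where "k = decode (- g)"
    have "c' u = P k + shift k + g" if u: "c' u - g \<in> ?E" for u
    proof -
      define x where "x = c' u - g"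
      have x: "\<And>n. P (decode x) \<in> covered n (decode x n)" "x = P (decode x) + shift (decode x)"
        using u unfolding x_def[symmetric] by auto
      have "decode (P (decode x) - cantor (e u) + shift (decode x)) = decode x"
        by (rule decode_eq) (rule x(1))
      moreover have "P (decode x) - cantor (e u) + shift (decode x) = x - cantor (e u)"
        using x(2) by (metis add.commute add_diff_eq diff_add_eq)
      moreover have "x - cantor (e u) = - g" by (simp add: x_def c'_def)
      ultimately have "decode x = k" by (simp add: k_def)
      then show ?thesis using x(2) by (simp add: x_def algebra_simps)
    qed
    note c'_eq = this
    have eq: "u = v" if "c' u - g \<in> ?E" "c' v - g \<in> ?E" for u v
    proof -
      have "cantor (e u) = cantor (e v)" using c'_eq[OF that(1)] c'_eq[OF that(2)] by (simp add: c'_def)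
      then show ?thesis using cantor_inj e(1) by (simp add: inj_eq)
    qed
    have "countable {u. c' u - g \<in> ?E}"
    proof (cases "\<exists>u. c' u - g \<in> ?E")
      case True
      then obtain u where "c' u - g \<in> ?E" by blast
      then have "{u. c' u - g \<in> ?E} \<subseteq> {u}" using eq by blast
      then show ?thesis by (rule countable_subset) simp
    next
      case False
      then have "{u. c' u - g \<in> ?E} = {}" by blast
      then show ?thesis by (simp only: countable_empty)
    qed
    then have null: "{u. c' u - g \<in> ?E} \<in> null_sets lborel" by (rule countable_imp_null_set_lborel)
    have "emeasure \<mu> {x. x - g \<in> ?E} = emeasure \<nu> (c' -` {x. x - g \<in> ?E} \<inter> space \<nu>)"
      unfolding \<mu>_def by (rule emeasure_distr[OF c' borel_translate[OF E]])
    also have "c' -` {x. x - g \<in> ?E} \<inter> space \<nu> = {u. c' u - g \<in> ?E}" by (auto simp: space_\<nu>)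
    also have "emeasure \<nu> {u. c' u - g \<in> ?E} = emeasure lborel ({0..1} \<inter> {u. c' u - g \<in> ?E}) / emeasure lborel {0..1::real}"
      unfolding \<nu>_def using null by (intro emeasure_uniform_measure) auto
    also have "emeasure lborel ({0..1} \<inter> {u. c' u - g \<in> ?E}) = 0"
      using null_set_Int1[OF null, of "{0..1}"] by (auto simp: null_sets_def)
    finally show ?thesis by simp
  qed
  moreover have "prob_space \<mu>" unfolding \<mu>_def by (rule prob_space.prob_space_distr[OF prob c'])
  ultimately show ?thesis
    unfolding haar_null_def translate_eq_Collect using E
    by (intro exI[of _ ?E] exI[of _ \<mu>]) (simp add: \<mu>_def)
qed

lemma exists_family_not_haar_null:
  fixes R :: "'i rel" and Z :: "'i set"
  assumes "wf R" "\<And>\<xi>. countable {\<eta>. (\<eta>, \<xi>) \<in> R}" "Z \<noteq> {}"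
    and "\<And>s :: nat \<Rightarrow> 'i. range s \<subseteq> Z \<Longrightarrow> \<exists>\<zeta>\<in>Z. \<forall>n. (s n, \<zeta>) \<in> R"
  shows "\<exists>E :: 'i \<Rightarrow> 'a set. (\<forall>\<xi>. haar_null (E \<xi>)) \<and> \<not> haar_null (\<Union>\<xi>\<in>Z. E \<xi>)"
proof -
  obtain H :: "'i \<Rightarrow> (nat \<Rightarrow> nat) \<Rightarrow> 'a \<Rightarrow> 'a"
    where H: "\<And>\<xi>. (\<lambda>(y, x). H \<xi> y x) \<in> borel_measurable (nat_seq \<Otimes>\<^sub>M borel)"
      and H_all: "\<And>h. h \<in> borel_measurable borel \<Longrightarrow> \<exists>\<xi>\<in>Z. \<exists>y. H \<xi> y = h"
    using exists_universal_borel_functions[OF assms, where 'a='a and 'b='a] by metis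
  \<comment> \<open>Each \<open>k n\<close> codes a pair: the second component is
    \<open>y n\<close>, the first lets \<open>k n\<close> be as large as a given compact set
    demands.\<close>
  define P where "P \<xi> k = H \<xi> (\<lambda>n. snd (prod_decode (k n))) (shift k)" for \<xi> k
  define E where "E \<xi> = {x. (\<forall>n. P \<xi> (decode x) \<in> covered n (decode x n)) \<and> x = P \<xi> (decode x) + shift (decode x)}" for \<xi>
  have P: "P \<xi> \<in> borel_measurable nat_seq" for \<xi>
  proof -
    have "(\<lambda>k. ((\<lambda>n. snd (prod_decode (k n))), shift k)) \<in> nat_seq \<rightarrow>\<^sub>M nat_seq \<Otimes>\<^sub>M borel"
    proof (intro measurable_Pair measurable_PiM_single' shift_measurable)
      show "(\<lambda>k. snd (prod_decode (k n))) \<in> nat_seq \<rightarrow>\<^sub>M count_space UNIV" for n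
        by (rule measurable_compose[OF measurable_component_singleton]) auto
    qed auto
    from measurable_compose[OF this H] show ?thesis by (simp add: P_def[abs_def])
  qed
  have "haar_null (E \<xi>)" for \<xi> unfolding E_def by (rule haar_null_decoded_points[OF P])
  moreover have "\<not> haar_null (\<Union>\<xi>\<in>Z. E \<xi>)"
  proof
    assume "haar_null (\<Union>\<xi>\<in>Z. E \<xi>)"
    then obtain B \<mu> where B: "B \<in> sets borel" "(\<Union>\<xi>\<in>Z. E \<xi>) \<subseteq> B" and \<mu>: "prob_space \<mu>" "sets \<mu> = sets borel"
      and null: "\<And>g. emeasure \<mu> {x. x - g \<in> B} = 0"
      unfolding haar_null_def translate_eq_Collect by blast
    obtain L h where L: "compact L" and h: "h \<in> borel_measurable borel" "\<And>t. h t \<in> L" "\<And>t. h t + t \<notin> B"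
      by (rule haar_null_witness_selector[OF B(1) \<mu> null]) (rule that)
    obtain \<xi> y where \<xi>: "\<xi> \<in> Z" "H \<xi> y = h" using H_all[OF h(1)] by blast
    obtain a where a: "\<And>n. L \<subseteq> covered n (a n)" using compact_covered[OF L] by metis
    define k where "k n = prod_encode (a n, y n)" for n
    have Pk: "P \<xi> k = h (shift k)" by (simp add: P_def k_def \<xi>(2))
    have "a n \<le> k n" for n unfolding k_def by (rule le_prod_encode_1)
    then have cov: "P \<xi> k \<in> covered n (k n)" for n
      using a[of n] covered_mono[of "a n" "k n" n] h(2)[of "shift k"] unfolding Pk by blast
    \<comment> \<open>Zero is the point of the Cantor set with all bits \<open>False\<close>, so
      decoding applies to \<open>P \<xi> k + shift k\<close> itself.\<close>
    have "decode (P \<xi> k - cantor (\<lambda>_. False) + shift k) = k" by (rule decode_eq) (rule cov)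
    moreover have "cantor (\<lambda>_. False) = 0" by (simp add: cantor_def)
    ultimately have dec: "decode (P \<xi> k + shift k) = k" by simp
    have "P \<xi> k + shift k \<in> E \<xi>" unfolding E_def by (simp add: dec cov)
    then show False using B(2) \<xi>(1) h(3)[of "shift k"] unfolding Pk by blast
  qed
  ultimately show ?thesis by blast
qed

end

section \<open>The first uncountable cardinal\<close>

lemma Card_order_omega_1: "Card_order omega_1"
  unfolding omega_1_def by (rule cardSuc_Card_order[OF natLeq_Card_order])

lemma omega_1_less_iff_countable: "|A| <o omega_1 \<longleftrightarrow> countable A"
  unfolding omega_1_def cardSuc_ordLeq_ordLess[OF natLeq_Card_order card_of_Card_order]
  by (simp only: countable_card_le_natLeq)

lemma omega_1_le_card_of_iff: "omega_1 \<le>o |A| \<longleftrightarrow> \<not> countable A"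
  using omega_1_less_iff_countable[of A] Card_order_omega_1 card_of_Card_order[of A]
  by (metis card_order_on_well_order_on not_ordLess_iff_ordLeq)

lemma uncountable_Field_omega_1: "\<not> countable (Field omega_1)"
  using card_of_Field_ordIso[OF Card_order_omega_1] omega_1_le_card_of_iff ordIso_iff_ordLeq by blast

lemma countable_below_omega_1: "countable {\<eta>. (\<eta>, \<xi>) \<in> omega_1 - Id}"
proof (cases "\<xi> \<in> Field omega_1")
  case True
  have "{\<eta>. (\<eta>, \<xi>) \<in> omega_1 - Id} = underS omega_1 \<xi>" by (auto simp: underS_def)
  then show ?thesis
    using card_of_underS[OF Card_order_omega_1 True] omega_1_less_iff_countable by metis
next
  case False
  then have "{\<eta>. (\<eta>, \<xi>) \<in> omega_1 - Id} = {}" by (auto simp: Field_def)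
  then show ?thesis by (simp only: countable_empty)
qed

text \<open>Regularity: an unbounded sequence would make the field a countable union of countable
  initial segments.\<close>

lemma countable_bounded_omega_1:
  fixes s :: "nat \<Rightarrow> nat set"
  assumes "range s \<subseteq> Field omega_1"
  shows "\<exists>\<zeta>\<in>Field omega_1. \<forall>n. (s n, \<zeta>) \<in> omega_1 - Id"
proof (rule ccontr)
  assume *: "\<not> ?thesis"
  have tot: "total_on (Field omega_1) omega_1"
    using Card_order_omega_1 by (simp add: card_order_on_def well_order_on_def linear_order_on_def)
  have "Field omega_1 \<subseteq> (\<Union>n. {\<eta>. (\<eta>, s n) \<in> omega_1 - Id} \<union> {s n})"
  proof
    fix \<zeta> assume \<zeta>: "\<zeta> \<in> Field omega_1"
    then obtain n where n: "(s n, \<zeta>) \<notin> omega_1 - Id" using * by blast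
    have "s n \<in> Field omega_1" using assms by blast
    then have "\<zeta> = s n \<or> (\<zeta>, s n) \<in> omega_1 - Id" using n tot \<zeta> unfolding total_on_def by blast
    then show "\<zeta> \<in> (\<Union>n. {\<eta>. (\<eta>, s n) \<in> omega_1 - Id} \<union> {s n})" by blast
  qed
  moreover have "countable (\<Union>n. {\<eta>. (\<eta>, s n) \<in> omega_1 - Id} \<union> {s n})"
    using countable_below_omega_1 by (intro countable_UN countable_Un) auto
  ultimately have "countable (Field omega_1)" by (rule countable_subset)
  then show False using uncountable_Field_omega_1 by contradiction
qed

theorem corollary1p5:
  assumes "\<not> locally_compact_space (euclidean :: 'a::{polish_space, topological_ab_group_add} topology)"
  shows "has_additivity {X :: 'a set. haar_null X} omega_1"
proof -
  have lower: "omega_1 \<le>o |A|" if "A \<subseteq> {X :: 'a set. haar_null X}" "\<Union>A \<notin> {X. haar_null X}" for A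
    using that haar_null_countable_Union[of A] unfolding omega_1_le_card_of_iff by blast
  obtain V :: "nat \<Rightarrow> 'a set" where "zero_nbhd_base V" using exists_zero_nbhd_base by blast
  then interpret zero_nbhd_base V .
  interpret polish_zero_nbhd_base V ..
  obtain m J c d g where "digit_scheme V m J c d g" using exists_digit_scheme[OF assms] by blast
  then interpret digit_scheme V m J c d g .
  have "Field omega_1 \<noteq> {}" using uncountable_Field_omega_1 by auto
  moreover have "wf (omega_1 - Id)"
    using Card_order_omega_1 by (simp add: card_order_on_def well_order_on_def)
  ultimately have "\<exists>E :: nat set \<Rightarrow> 'a set. (\<forall>\<xi>. haar_null (E \<xi>)) \<and> \<not> haar_null (\<Union>\<xi>\<in>Field omega_1. E \<xi>)"
    by (intro exists_family_not_haar_null[OF _ countable_below_omega_1 _ countable_bounded_omega_1])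
  then obtain E :: "nat set \<Rightarrow> 'a set"
    where E: "\<And>\<xi>. haar_null (E \<xi>)" "\<not> haar_null (\<Union>\<xi>\<in>Field omega_1. E \<xi>)"
    by blast
  have "E ` Field omega_1 \<subseteq> {X. haar_null X}" "\<Union>(E ` Field omega_1) \<notin> {X. haar_null X}"
    using E by auto
  \<comment> \<open>An image has at most the cardinality of its index set; the lower bound, applied
    to this very family, supplies the converse.\<close>
  moreover from lower[OF this] have "|E ` Field omega_1| =o omega_1"
    using card_of_image[of E "Field omega_1"] card_of_Field_ordIso[OF Card_order_omega_1]
      ordIso_iff_ordLeq ordLeq_ordIso_trans by blast
  ultimately show ?thesis
    unfolding has_additivity_def using Card_order_omega_1 lower by blast
qed

end
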